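(* Let $\mathrm{UT}_3(\mathbb{R})$ be the semigroup, under matrix multiplication, of all upper triangular real $3\times 3$-matrices each of whose main diagonal entries is $0$ or $1$. Then $\mathrm{UT}_3(\mathbb{R})$ is nonfinitely based as a plain semigroup, and it is also nonfinitely based as an involution semigroup under the skew transposition $\alpha\mapsto\alpha^D$.
   Context: Skew transposition: for a matrix $\alpha=(\alpha_{ij})\in\mathrm{UT}_3(\mathbb{R})$, $\alpha^D$ is the matrix obtained by reflecting $\alpha$ with respect to the secondary diagonal (from the top right to the bottom left corner), i.e. the $(i,j)$ entry of $\alpha^D$ is $\alpha_{4-j\,4-i}$. This is an involutory anti-automorphism of $\mathrm{UT}_3(\mathbb{R})$. Plain semigroups: a semigroup identity is a pair $(u,v)$ of words, i.e. elements of the free semigroup $A^+$ over an alphabet $A$ (letters may be taken from a fixed countably infinite alphabet). A semigroup $S$ satisfies the identity $(u,v)$, where $u,v\in A^+$, if $u\varphi=v\varphi$ for every semigroup homomorphism $\varphi:A^+\to S$ (we also say that the identity holds in $S$). An identity follows from a system $\Sigma$ of identities if every semigroup satisfying all identities of $\Sigma$ satisfies it. A semigroup $S$ is finitely based if there is a finite system $\Sigma$ of identities holding in $S$ such that every identity holding in $S$ follows from $\Sigma$; otherwise $S$ is nonfinitely based. Involution semigroups: an involution semigroup is an algebra $\langle S,\cdot,{}^\star\rangle$ of type $(2,1)$ such that $\langle S,\cdot\rangle$ is a semigroup and $(xy)^\star=y^\star x^\star$, $(x^\star)^\star=x$ for all $x,y\in S$. The free involution semigroup $\mathcal{FI}(A)$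 on an alphabet $A$ is the free semigroup $(A\cup\overline{A})^+$, where $\overline{A}=\{a^\star\mid a\in A\}$ is a disjoint copy of $A$, with $(a^\star)^\star:=a$ and $(a_1\cdots a_m)^\star:=a_m^\star\cdots a_1^\star$ for all $a_1,\dots,a_m\in A\cup\overline{A}$. An involutory identity is a pair $(u,v)$ of elements of $\mathcal{FI}(A)$; it holds in an involution semigroup $S$ if $u\varphi=v\varphi$ for every involution semigroup homomorphism $\varphi:\mathcal{FI}(A)\to S$. The notions "follows from", "finitely based" and "nonfinitely based" for involution semigroups are defined exactly as in the plain case, with involution semigroups and involutory identities in place of semigroups and semigroup identities. *)

theory Defs
  imports "HOL-Analysis.Analysis"
begin

section \<open>Plain semigroups\<close>

definition semigroup_on :: "'s set \<Rightarrow> ('s \<Rightarrow> 's \<Rightarrow> 's) \<Rightarrow> bool" where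
  "semigroup_on S f \<longleftrightarrow>
     (\<forall>x\<in>S. \<forall>y\<in>S. f x y \<in> S) \<and>
     (\<forall>x\<in>S. \<forall>y\<in>S. \<forall>z\<in>S. f (f x y) z = f x (f y z))"

definition semigroup_hom ::
    "'s set \<Rightarrow> ('s \<Rightarrow> 's \<Rightarrow> 's) \<Rightarrow> 't set \<Rightarrow> ('t \<Rightarrow> 't \<Rightarrow> 't) \<Rightarrow> ('s \<Rightarrow> 't) \<Rightarrow> bool" where
  "semigroup_hom S f T g \<phi> \<longleftrightarrow>
     (\<forall>x\<in>S. \<phi> x \<in> T) \<and> (\<forall>x\<in>S. \<forall>y\<in>S. \<phi> (f x y) = g (\<phi> x) (\<phi> y))"

text \<open>The free semigroup on an alphabet (a type of letters) is the set of nonempty lists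
  of letters under concatenation.\<close>

definition words :: "'l list set" where
  "words = {w. w \<noteq> []}"

text \<open>Plain identities use the letters 0, 1, 2, ...\<close>

type_synonym identity = "nat list \<times> nat list"

definition satisfies :: "'s set \<Rightarrow> ('s \<Rightarrow> 's \<Rightarrow> 's) \<Rightarrow> identity \<Rightarrow> bool" where
  "satisfies S f e \<longleftrightarrow>
     (\<forall>\<phi>. semigroup_hom words (@) S f \<phi> \<longrightarrow> \<phi> (fst e) = \<phi> (snd e))"

text \<open>HOL cannot quantify over all types inside a definition, so the semigroups in the definition
  of consequence have carriers that are arbitrary subsets of a type \<open>'u\<close>. For every infinite
  \<open>'u\<close> this is consequence over all semigroups: see \<open>follows_from_universal\<close> below.\<close>

definition follows_from :: "'u itself \<Rightarrow> identity set \<Rightarrow> identity \<Rightarrow> bool" where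
  "follows_from (U :: 'u itself) \<Sigma> e \<longleftrightarrow>
     (\<forall>(T :: 'u set) g. semigroup_on T g \<longrightarrow> (\<forall>d\<in>\<Sigma>. satisfies T g d) \<longrightarrow> satisfies T g e)"

definition finitely_based :: "'u itself \<Rightarrow> 's set \<Rightarrow> ('s \<Rightarrow> 's \<Rightarrow> 's) \<Rightarrow> bool" where
  "finitely_based U S f \<longleftrightarrow>
     (\<exists>\<Sigma> \<subseteq> words \<times> words. finite \<Sigma> \<and> (\<forall>d\<in>\<Sigma>. satisfies S f d) \<and>
        (\<forall>e \<in> words \<times> words. satisfies S f e \<longrightarrow> follows_from U \<Sigma> e))"


section \<open>Involution semigroups\<close>

definition inv_semigroup_on :: "'s set \<Rightarrow> ('s \<Rightarrow> 's \<Rightarrow> 's) \<Rightarrow> ('s \<Rightarrow> 's) \<Rightarrow> bool" where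
  "inv_semigroup_on S f st \<longleftrightarrow>
     semigroup_on S f \<and> (\<forall>x\<in>S. st x \<in> S) \<and>
     (\<forall>x\<in>S. \<forall>y\<in>S. st (f x y) = f (st y) (st x)) \<and> (\<forall>x\<in>S. st (st x) = x)"

definition inv_semigroup_hom ::
    "'s set \<Rightarrow> ('s \<Rightarrow> 's \<Rightarrow> 's) \<Rightarrow> ('s \<Rightarrow> 's) \<Rightarrow>
     't set \<Rightarrow> ('t \<Rightarrow> 't \<Rightarrow> 't) \<Rightarrow> ('t \<Rightarrow> 't) \<Rightarrow> ('s \<Rightarrow> 't) \<Rightarrow> bool" where
  "inv_semigroup_hom S f st T g st' \<phi> \<longleftrightarrow>
     semigroup_hom S f T g \<phi> \<and> (\<forall>x\<in>S. \<phi> (st x) = st' (\<phi> x))"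

text \<open>The free involution semigroup on the letters 0, 1, 2, ...: \<open>Inl a\<close> is the letter \<open>a\<close> and
  \<open>Inr a\<close> its formal star. The operation \<open>case_sum Inr Inl\<close> exchanges the two.\<close>

type_synonym inv_identity = "(nat + nat) list \<times> (nat + nat) list"

definition word_star :: "('a + 'a) list \<Rightarrow> ('a + 'a) list" where
  "word_star w = rev (map (case_sum Inr Inl) w)"

definition inv_satisfies ::
    "'s set \<Rightarrow> ('s \<Rightarrow> 's \<Rightarrow> 's) \<Rightarrow> ('s \<Rightarrow> 's) \<Rightarrow> inv_identity \<Rightarrow> bool" where
  "inv_satisfies S f st e \<longleftrightarrow>
     (\<forall>\<phi>. inv_semigroup_hom words (@) word_star S f st \<phi> \<longrightarrow> \<phi> (fst e) = \<phi> (snd e))"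

definition inv_follows_from :: "'u itself \<Rightarrow> inv_identity set \<Rightarrow> inv_identity \<Rightarrow> bool" where
  "inv_follows_from (U :: 'u itself) \<Sigma> e \<longleftrightarrow>
     (\<forall>(T :: 'u set) g st. inv_semigroup_on T g st \<longrightarrow>
        (\<forall>d\<in>\<Sigma>. inv_satisfies T g st d) \<longrightarrow> inv_satisfies T g st e)"

definition inv_finitely_based ::
    "'u itself \<Rightarrow> 's set \<Rightarrow> ('s \<Rightarrow> 's \<Rightarrow> 's) \<Rightarrow> ('s \<Rightarrow> 's) \<Rightarrow> bool" where
  "inv_finitely_based U S f st \<longleftrightarrow>
     (\<exists>\<Sigma> \<subseteq> words \<times> words. finite \<Sigma> \<and> (\<forall>d\<in>\<Sigma>. inv_satisfies S f st d) \<and>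
        (\<forall>e \<in> words \<times> words. inv_satisfies S f st e \<longrightarrow> inv_follows_from U \<Sigma> e))"


section \<open>Independence of the universe\<close>

lemma follows_from_universal:
  fixes T :: "'t set"
  assumes inf: "infinite (UNIV :: 'u set)"
    and ff: "follows_from TYPE('u) \<Sigma> e" and sg: "semigroup_on T g"
    and sat: "\<And>d. d \<in> \<Sigma> \<Longrightarrow> satisfies T g d"
    and e: "e \<in> words \<times> words" and \<Sigma>: "\<Sigma> \<subseteq> words \<times> words"
  shows "satisfies T g e"
  unfolding satisfies_def
proof (intro allI impI)
  fix \<phi> :: "nat list \<Rightarrow> 't" assume \<phi>: "semigroup_hom words (@) T g \<phi>"
  define R where "R = \<phi> ` words"
  have app: "u @ v \<in> words" if "u \<in> words" for u v :: "nat list"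
    using that by (simp add: words_def)
  have \<phi>R: "\<phi> w \<in> R" if "w \<in> words" for w using that by (simp add: R_def)
  have RT: "R \<subseteq> T" using \<phi> by (auto simp: R_def semigroup_hom_def)
  have Rg: "g x y \<in> R" if xy: "x \<in> R" "y \<in> R" for x y
  proof -
    obtain u v where uv: "u \<in> words" "v \<in> words" "x = \<phi> u" "y = \<phi> v"
      using xy by (auto simp: R_def)
    then have "g x y = \<phi> (u @ v)" using \<phi> by (simp add: semigroup_hom_def)
    then show ?thesis using app[OF uv(1)] by (simp add: R_def)
  qed
  have "countable R" by (simp add: R_def)
  obtain N :: "'u set" where N: "countable N" "infinite N"
    using infinite_countable_subset'[OF inf] by auto
  define i where "i = from_nat_into N \<circ> to_nat_on R"
  have inj: "inj_on i R"
    unfolding i_def by (intro comp_inj_on inj_on_to_nat_on \<open>countable R\<close>)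
      (metis N bij_betw_from_nat_into bij_betw_imp_inj_on inj_on_subset subset_UNIV)
  define j where "j = the_inv_into R i"
  have ji: "j (i x) = x" if "x \<in> R" for x
    using that inj by (simp add: j_def the_inv_into_f_f)
  define h where "h = (\<lambda>x y. i (g (j x) (j y)))"
  have hi: "h (i x) (i y) = i (g x y)" if "x \<in> R" "y \<in> R" for x y
    using that by (simp add: h_def ji)
  have assoc: "g (g x y) z = g x (g y z)" if "x \<in> R" "y \<in> R" "z \<in> R" for x y z
    using that sg RT unfolding semigroup_on_def by blast
  have sg': "semigroup_on (i ` R) h"
    unfolding semigroup_on_def by (simp add: hi Rg assoc)
  have "satisfies (i ` R) h d" if "d \<in> \<Sigma>" for d
    unfolding satisfies_def
  proof (intro allI impI)
    fix \<psi> :: "nat list \<Rightarrow> 'u" assume \<psi>: "semigroup_hom words (@) (i ` R) h \<psi>"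
    have \<psi>R: "\<exists>r\<in>R. \<psi> x = i r" if "x \<in> words" for x
      using \<psi> that by (auto simp: semigroup_hom_def)
    have "semigroup_hom words (@) T g (j \<circ> \<psi>)"
      unfolding semigroup_hom_def
    proof (intro conjI ballI)
      show "(j \<circ> \<psi>) x \<in> T" if "x \<in> words" for x
        using \<psi>R[OF that] RT by (auto simp: ji)
      fix x y :: "nat list" assume xy: "x \<in> words" "y \<in> words"
      obtain a b where ab: "a \<in> R" "b \<in> R" "\<psi> x = i a" "\<psi> y = i b"
        using \<psi>R[OF xy(1)] \<psi>R[OF xy(2)] by blast
      have "\<psi> (x @ y) = h (\<psi> x) (\<psi> y)"
        using \<psi> xy unfolding semigroup_hom_def by blast
      then show "(j \<circ> \<psi>) (x @ y) = g ((j \<circ> \<psi>) x) ((j \<circ> \<psi>) y)"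
        using ab by (simp add: hi ji Rg)
    qed
    with sat[OF that] have "j (\<psi> (fst d)) = j (\<psi> (snd d))"
      unfolding satisfies_def by (metis comp_apply)
    moreover have "fst d \<in> words" "snd d \<in> words" using \<Sigma> that by auto
    ultimately show "\<psi> (fst d) = \<psi> (snd d)" using \<psi>R ji by metis
  qed
  with ff sg' have "satisfies (i ` R) h e" unfolding follows_from_def by blast
  moreover have "semigroup_hom words (@) (i ` R) h (i \<circ> \<phi>)"
    using \<phi> \<phi>R hi by (simp add: semigroup_hom_def)
  ultimately have "(i \<circ> \<phi>) (fst e) = (i \<circ> \<phi>) (snd e)"
    unfolding satisfies_def by blast
  then show "\<phi> (fst e) = \<phi> (snd e)"
    using inj_onD[OF inj] \<phi>R e by (metis comp_apply mem_Times_iff)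
qed

lemma inv_follows_from_universal:
  fixes T :: "'t set"
  assumes inf: "infinite (UNIV :: 'u set)"
    and ff: "inv_follows_from TYPE('u) \<Sigma> e" and sg: "inv_semigroup_on T g st"
    and sat: "\<And>d. d \<in> \<Sigma> \<Longrightarrow> inv_satisfies T g st d"
    and e: "e \<in> words \<times> words" and \<Sigma>: "\<Sigma> \<subseteq> words \<times> words"
  shows "inv_satisfies T g st e"
  unfolding inv_satisfies_def
proof (intro allI impI)
  fix \<phi> :: "(nat + nat) list \<Rightarrow> 't" assume \<phi>: "inv_semigroup_hom words (@) word_star T g st \<phi>"
  define R where "R = \<phi> ` words"
  have app: "u @ v \<in> words" if "u \<in> words" for u v :: "(nat + nat) list"
    using that by (simp add: words_def)
  have ws: "word_star u \<in> words" if "u \<in> words" for u :: "(nat + nat) list"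
    using that by (simp add: words_def word_star_def)
  have \<phi>R: "\<phi> w \<in> R" if "w \<in> words" for w using that by (simp add: R_def)
  have RT: "R \<subseteq> T" using \<phi> by (auto simp: R_def semigroup_hom_def inv_semigroup_hom_def)
  have Rg: "g x y \<in> R" if xy: "x \<in> R" "y \<in> R" for x y
  proof -
    obtain u v where uv: "u \<in> words" "v \<in> words" "x = \<phi> u" "y = \<phi> v"
      using xy by (auto simp: R_def)
    then have "g x y = \<phi> (u @ v)" using \<phi> by (simp add: semigroup_hom_def inv_semigroup_hom_def)
    then show ?thesis using app[OF uv(1)] by (simp add: R_def)
  qed
  have Rs: "st x \<in> R" if x: "x \<in> R" for x
  proof -
    obtain u where u: "u \<in> words" "x = \<phi> u" using x by (auto simp: R_def)
    then have "st x = \<phi> (word_star u)" using \<phi> by (simp add: inv_semigroup_hom_def)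
    then show ?thesis using ws[OF u(1)] by (simp add: R_def)
  qed
  have "countable R" by (simp add: R_def)
  obtain N :: "'u set" where N: "countable N" "infinite N"
    using infinite_countable_subset'[OF inf] by auto
  define i where "i = from_nat_into N \<circ> to_nat_on R"
  have inj: "inj_on i R"
    unfolding i_def by (intro comp_inj_on inj_on_to_nat_on \<open>countable R\<close>)
      (metis N bij_betw_from_nat_into bij_betw_imp_inj_on inj_on_subset subset_UNIV)
  define j where "j = the_inv_into R i"
  have ji: "j (i x) = x" if "x \<in> R" for x
    using that inj by (simp add: j_def the_inv_into_f_f)
  define h where "h = (\<lambda>x y. i (g (j x) (j y)))"
  define s where "s = (\<lambda>x. i (st (j x)))"
  have hi: "h (i x) (i y) = i (g x y)" if "x \<in> R" "y \<in> R" for x y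
    using that by (simp add: h_def ji)
  have assoc: "g (g x y) z = g x (g y z)" if "x \<in> R" "y \<in> R" "z \<in> R" for x y z
    using that sg RT unfolding inv_semigroup_on_def semigroup_on_def by blast
  have si: "s (i x) = i (st x)" if "x \<in> R" for x
    using that by (simp add: s_def ji)
  have anti: "st (g x y) = g (st y) (st x)" if "x \<in> R" "y \<in> R" for x y
    using that sg RT unfolding inv_semigroup_on_def by blast
  have inv: "st (st x) = x" if "x \<in> R" for x
    using that sg RT unfolding inv_semigroup_on_def by blast
  have sg': "inv_semigroup_on (i ` R) h s"
    unfolding inv_semigroup_on_def semigroup_on_def by (simp add: hi si Rg Rs assoc anti inv)
  have "inv_satisfies (i ` R) h s d" if "d \<in> \<Sigma>" for d
    unfolding inv_satisfies_def
  proof (intro allI impI)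
    fix \<psi> :: "(nat + nat) list \<Rightarrow> 'u"
    assume \<psi>: "inv_semigroup_hom words (@) word_star (i ` R) h s \<psi>"
    have \<psi>R: "\<exists>r\<in>R. \<psi> x = i r" if "x \<in> words" for x
      using \<psi> that by (auto simp: semigroup_hom_def inv_semigroup_hom_def)
    have "inv_semigroup_hom words (@) word_star T g st (j \<circ> \<psi>)"
      unfolding semigroup_hom_def inv_semigroup_hom_def
    proof (intro conjI ballI)
      show "(j \<circ> \<psi>) x \<in> T" if "x \<in> words" for x
        using \<psi>R[OF that] RT by (auto simp: ji)
      show "(j \<circ> \<psi>) (word_star x) = st ((j \<circ> \<psi>) x)" if xw: "x \<in> words" for x
      proof -
        obtain a where a: "a \<in> R" "\<psi> x = i a" using \<psi>R[OF xw] by blast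
        have "\<psi> (word_star x) = s (\<psi> x)"
          using \<psi> xw unfolding inv_semigroup_hom_def by blast
        then show ?thesis using a by (simp add: si ji Rs)
      qed
      fix x y :: "(nat + nat) list" assume xy: "x \<in> words" "y \<in> words"
      obtain a b where ab: "a \<in> R" "b \<in> R" "\<psi> x = i a" "\<psi> y = i b"
        using \<psi>R[OF xy(1)] \<psi>R[OF xy(2)] by blast
      have "\<psi> (x @ y) = h (\<psi> x) (\<psi> y)"
        using \<psi> xy unfolding inv_semigroup_hom_def semigroup_hom_def by blast
      then show "(j \<circ> \<psi>) (x @ y) = g ((j \<circ> \<psi>) x) ((j \<circ> \<psi>) y)"
        using ab by (simp add: hi ji Rg)
    qed
    with sat[OF that] have "j (\<psi> (fst d)) = j (\<psi> (snd d))"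
      unfolding inv_satisfies_def by (metis comp_apply)
    moreover have "fst d \<in> words" "snd d \<in> words" using \<Sigma> that by auto
    ultimately show "\<psi> (fst d) = \<psi> (snd d)" using \<psi>R ji by metis
  qed
  with ff sg' have "inv_satisfies (i ` R) h s e" unfolding inv_follows_from_def by blast
  moreover have "inv_semigroup_hom words (@) word_star (i ` R) h s (i \<circ> \<phi>)"
    using \<phi> \<phi>R hi si by (simp add: semigroup_hom_def inv_semigroup_hom_def)
  ultimately have "(i \<circ> \<phi>) (fst e) = (i \<circ> \<phi>) (snd e)"
    unfolding inv_satisfies_def by blast
  then show "\<phi> (fst e) = \<phi> (snd e)"
    using inj_onD[OF inj] \<phi>R e by (metis comp_apply mem_Times_iff)
qed


section \<open>Triangular matrices and skew transposition\<close>

text \<open>Rows and columns are labelled 1, 2, 3. The order of the index type \<open>3\<close> is not used, as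
  \<open>3 = 0\<close> is its least element. Index arithmetic is modulo 3, where \<open>4 - 1 = 3\<close>,
  \<open>4 - 2 = 2\<close>, \<open>4 - 3 = 1\<close> as required.\<close>

definition UT3 :: "(real ^ 3 ^ 3) set" where
  "UT3 = {M. M $ 2 $ 1 = 0 \<and> M $ 3 $ 1 = 0 \<and> M $ 3 $ 2 = 0 \<and> (\<forall>i. M $ i $ i \<in> {0, 1})}"

definition skew_transpose :: "real ^ 3 ^ 3 \<Rightarrow> real ^ 3 ^ 3" where
  "skew_transpose M = (\<chi> i j. M $ (4 - j) $ (4 - i))"

lemma inv_semigroup_on_UT3: "inv_semigroup_on UT3 (**) skew_transpose"
proof -
  have s: "(4::3) - 1 = 3" "(4::3) - 2 = 2" "(4::3) - 3 = 1" by simp_all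
  have d: "skew_transpose M $ 1 $ 1 = M $ 3 $ 3" "skew_transpose M $ 1 $ 2 = M $ 2 $ 3"
    "skew_transpose M $ 1 $ 3 = M $ 1 $ 3" "skew_transpose M $ 2 $ 1 = M $ 3 $ 2"
    "skew_transpose M $ 2 $ 2 = M $ 2 $ 2" "skew_transpose M $ 2 $ 3 = M $ 1 $ 2"
    "skew_transpose M $ 3 $ 1 = M $ 3 $ 1" "skew_transpose M $ 3 $ 2 = M $ 2 $ 1"
    "skew_transpose M $ 3 $ 3 = M $ 1 $ 1" for M
    unfolding skew_transpose_def vec_lambda_beta s by (rule refl)+
  have p: "(M ** N) $ i $ j = M$i$1 * N$1$j + M$i$2 * N$2$j + M$i$3 * N$3$j"
    for M N :: "real^3^3" and i j
    unfolding matrix_matrix_mult_def vec_lambda_beta sum_3 by (rule refl)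
  have U: "M \<in> UT3 \<longleftrightarrow> M$2$1 = 0 \<and> M$3$1 = 0 \<and> M$3$2 = 0 \<and>
      (M$1$1 = 0 \<or> M$1$1 = 1) \<and> (M$2$2 = 0 \<or> M$2$2 = 1) \<and> (M$3$3 = 0 \<or> M$3$3 = 1)" for M
    unfolding UT3_def mem_Collect_eq forall_3 insert_iff empty_iff by blast
  have "M ** N \<in> UT3" if "M \<in> UT3" "N \<in> UT3" for M N
    using that unfolding U p by (elim conjE disjE) simp_all
  moreover have "skew_transpose M \<in> UT3" if "M \<in> UT3" for M
    using that unfolding U d by blast
  moreover have "skew_transpose (M ** N) = skew_transpose N ** skew_transpose M" for M N
    unfolding vec_eq_iff forall_3 d p by (simp only: ac_simps simp_thms)
  moreover have "skew_transpose (skew_transpose M) = M" for M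
    unfolding vec_eq_iff forall_3 d by blast
  ultimately show ?thesis
    unfolding inv_semigroup_on_def semigroup_on_def by (simp add: matrix_mul_assoc)
qed

end

theory Submission imports Defs begin

text \<open>The (1,3) entry of a product of triangular matrices counts factors \<open>a q b\<close> of a word with
  \<open>q\<close> over a prescribed set of letters. So a word \<open>w\<close> equal in \<open>UT3\<close> to a given word \<open>u\<close> has the
  same adjacent pairs as \<open>u\<close>, and factors of \<open>u\<close> whose adjacent pairs occur only once in \<open>u\<close> reappear
  in \<open>w\<close>.

  If \<open>X\<close> and \<open>Y\<close> are permutations of the word \<open>f = 0 1 ... (2n-1)\<close>, then \<open>UT3\<close> satisfies
  \<open>f f X f Y f f = f f Y f X f f\<close>: the three blocks have the same diagonal, and if it is the
  identity, they agree modulo the centre of a group of class 2. Take \<open>X\<close> to start with the even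
  letters in increasing order, a block \<open>E\<close>, and let \<open>Y = D\<close> be the reversal of \<open>f\<close>.
  Apply to a word equal to the left-hand side an identity \<open>s = t\<close> of \<open>UT3\<close> with \<open>s\<close> shorter than
  \<open>n - 3\<close>. By the pigeonhole principle the value of a single letter of \<open>s\<close> contains an adjacent pair of
  \<open>E\<close>, and likewise for \<open>D\<close>. These letters occur once in \<open>s\<close>, hence once in \<open>t\<close> and in the same order, so
  \<open>E\<close> still precedes \<open>D\<close>; on the right-hand side it does not. An involutory identity that applies to
  an unstarred word acts there as a plain identity.\<close>

section \<open>Evaluating words in triangular matrices\<close>

lemma matrix_mult_entry3:
  "(M ** N) $ i $ j = M$i$1 * N$1$j + M$i$2 * N$2$j + M$i$3 * N$3$j"
  for M N :: "real^3^3"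
  by (simp add: matrix_matrix_mult_def sum_3)

lemma UT3_iff: "M \<in> UT3 \<longleftrightarrow> M$2$1 = 0 \<and> M$3$1 = 0 \<and> M$3$2 = 0 \<and>
    M$1$1 \<in> {0,1} \<and> M$2$2 \<in> {0,1} \<and> M$3$3 \<in> {0,1}"
  by (simp add: UT3_def forall_3)

lemma mat_1_in_UT3: "mat 1 \<in> UT3"
  by (simp add: UT3_iff mat_def)

lemma UT3_mult: "M \<in> UT3 \<Longrightarrow> N \<in> UT3 \<Longrightarrow> M ** N \<in> UT3"
  using inv_semigroup_on_UT3 by (simp add: inv_semigroup_on_def semigroup_on_def)

lemma skew_transpose_UT3: "M \<in> UT3 \<Longrightarrow> skew_transpose M \<in> UT3"
  using inv_semigroup_on_UT3 by (simp add: inv_semigroup_on_def)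

lemma skew_transpose_skew_transpose: "M \<in> UT3 \<Longrightarrow> skew_transpose (skew_transpose M) = M"
  using inv_semigroup_on_UT3 by (simp add: inv_semigroup_on_def)

lemma skew_transpose_mult:
  "M \<in> UT3 \<Longrightarrow> N \<in> UT3 \<Longrightarrow> skew_transpose (M ** N) = skew_transpose N ** skew_transpose M"
  using inv_semigroup_on_UT3 by (simp add: inv_semigroup_on_def)

text \<open>The fold ends in the identity matrix, which lies in \<open>UT3\<close>, so the empty
  word has a value and substitutions may erase letters.\<close>

definition eval_word :: "('a \<Rightarrow> real^3^3) \<Rightarrow> 'a list \<Rightarrow> real^3^3" where
  "eval_word m w = foldr (\<lambda>x M. m x ** M) w (mat 1)"

lemma eval_word_Nil [simp]: "eval_word m [] = mat 1"
  and eval_word_Cons [simp]: "eval_word m (x # w) = m x ** eval_word m w"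
  by (simp_all add: eval_word_def)

lemma eval_word_append [simp]: "eval_word m (u @ v) = eval_word m u ** eval_word m v"
  by (induction u) (simp_all add: matrix_mul_assoc)

lemma eval_word_concat: "eval_word m (concat (map \<phi> w)) = eval_word (\<lambda>x. eval_word m (\<phi> x)) w"
  by (induction w) simp_all

lemma eval_word_cong: "(\<And>x. x \<in> set w \<Longrightarrow> m x = m' x) \<Longrightarrow> eval_word m w = eval_word m' w"
  by (induction w) simp_all

lemma eval_word_in_UT3: "(\<And>x. x \<in> set w \<Longrightarrow> m x \<in> UT3) \<Longrightarrow> eval_word m w \<in> UT3"
  by (induction w) (simp_all add: mat_1_in_UT3 UT3_mult)

lemma semigroup_hom_words_eval:
  assumes "semigroup_hom words (@) UT3 (**) \<phi>" "w \<noteq> []"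
  shows "\<phi> w = eval_word (\<lambda>x. \<phi> [x]) w"
  using assms(2)
proof (induction w rule: list_nonempty_induct)
  case (cons x xs)
  then have "\<phi> ([x] @ xs) = \<phi> [x] ** \<phi> xs"
    using assms(1) unfolding semigroup_hom_def words_def by blast
  with cons show ?case by simp
qed simp

text \<open>For nonempty words over the natural numbers this is satisfaction of an identity. The
  free type of letters later admits fresh letters and starred letters as ordinary ones.\<close>

definition UT3_equiv :: "'a list \<Rightarrow> 'a list \<Rightarrow> bool" where
  "UT3_equiv u v \<longleftrightarrow> (\<forall>m. range m \<subseteq> UT3 \<longrightarrow> eval_word m u = eval_word m v)"

lemma UT3_equivD: "UT3_equiv u v \<Longrightarrow> (\<And>x. m x \<in> UT3) \<Longrightarrow> eval_word m u = eval_word m v"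
  unfolding UT3_equiv_def by blast

lemma UT3_equiv_refl: "UT3_equiv u u"
  and UT3_equiv_sym: "UT3_equiv u v \<Longrightarrow> UT3_equiv v u"
  and UT3_equiv_trans: "UT3_equiv u v \<Longrightarrow> UT3_equiv v w \<Longrightarrow> UT3_equiv u w"
  by (simp_all add: UT3_equiv_def)

text \<open>Evaluating after a substitution is the same as evaluating the original word under
  another assignment in \<open>UT3\<close>; the context only multiplies both sides.\<close>

lemma UT3_equiv_subst:
  assumes "UT3_equiv s t"
  shows "UT3_equiv (a @ concat (map \<phi> s) @ b) (a @ concat (map \<phi> t) @ b)"
proof -
  have "eval_word m (concat (map \<phi> s)) = eval_word m (concat (map \<phi> t))" if "range m \<subseteq> UT3" for m
    unfolding eval_word_concat
    using that by (intro UT3_equivD[OF assms] eval_word_in_UT3) auto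
  then show ?thesis by (simp add: UT3_equiv_def)
qed

lemma UT3_equiv_map: "UT3_equiv s t \<Longrightarrow> UT3_equiv (map g s) (map g t)"
  using UT3_equiv_subst[of s t "[]" "\<lambda>x. [g x]" "[]"] by simp

lemma satisfies_UT3_iff:
  assumes "u \<noteq> []" "v \<noteq> []"
  shows "satisfies UT3 (**) (u, v) \<longleftrightarrow> UT3_equiv u v"
proof
  assume L: "satisfies UT3 (**) (u, v)"
  show "UT3_equiv u v"
    unfolding UT3_equiv_def
  proof (intro allI impI)
    fix m :: "nat \<Rightarrow> real^3^3" assume "range m \<subseteq> UT3"
    then have "semigroup_hom words (@) UT3 (**) (eval_word m)"
      unfolding semigroup_hom_def by (auto intro!: eval_word_in_UT3)
    with L show "eval_word m u = eval_word m v" by (simp add: satisfies_def)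
  qed
next
  assume R: "UT3_equiv u v"
  show "satisfies UT3 (**) (u, v)"
    unfolding satisfies_def
  proof (intro allI impI)
    fix \<phi> :: "nat list \<Rightarrow> real^3^3" assume h: "semigroup_hom words (@) UT3 (**) \<phi>"
    have "\<phi> [x] \<in> UT3" for x using h by (simp add: semigroup_hom_def words_def)
    then have "eval_word (\<lambda>x. \<phi> [x]) u = eval_word (\<lambda>x. \<phi> [x]) v"
      by (intro UT3_equivD[OF R])
    then show "\<phi> (fst (u, v)) = \<phi> (snd (u, v))"
      by (simp only: fst_conv snd_conv semigroup_hom_words_eval[OF h assms(1)]
          semigroup_hom_words_eval[OF h assms(2)])
  qed
qed

section \<open>Counting factors\<close>

text \<open>\<open>prefix_count B b w\<close> and \<open>factor_count B a b w\<close> are the numbers of decompositions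
  \<open>w = q b r\<close> and \<open>w = p a q b r\<close> in which \<open>q\<close> is a word over \<open>B\<close>.\<close>

fun prefix_count :: "'a set \<Rightarrow> 'a \<Rightarrow> 'a list \<Rightarrow> nat" where
  "prefix_count B b [] = 0"
| "prefix_count B b (z # w) = of_bool (z = b) + of_bool (z \<in> B) * prefix_count B b w"

fun factor_count :: "'a set \<Rightarrow> 'a \<Rightarrow> 'a \<Rightarrow> 'a list \<Rightarrow> nat" where
  "factor_count B a b [] = 0"
| "factor_count B a b (z # w) = factor_count B a b w + of_bool (z = a) * prefix_count B b w"

definition triangular :: "real \<Rightarrow> real \<Rightarrow> real \<Rightarrow> real^3^3" where
  "triangular d a b = (\<chi> i j. if i = j then (if i = 2 then d else 1)
     else if i = 1 \<and> j = 2 then a else if i = 2 \<and> j = 3 then b else 0)"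

lemma triangular_entries [simp]:
  "triangular d a b $ 1 $ 1 = 1" "triangular d a b $ 1 $ 2 = a" "triangular d a b $ 1 $ 3 = 0"
  "triangular d a b $ 2 $ 1 = 0" "triangular d a b $ 2 $ 2 = d" "triangular d a b $ 2 $ 3 = b"
  "triangular d a b $ 3 $ 1 = 0" "triangular d a b $ 3 $ 2 = 0" "triangular d a b $ 3 $ 3 = 1"
  by (simp_all add: triangular_def)

lemma triangular_in_UT3: "d \<in> {0, 1} \<Longrightarrow> triangular d a b \<in> UT3"
  by (simp add: UT3_iff)

lemma skew_transpose_triangular: "skew_transpose (triangular d a b) = triangular d b a"
proof -
  have s: "(4::3) - 1 = 3" "(4::3) - 2 = 2" "(4::3) - 3 = 1" by simp_all
  show ?thesis
    unfolding vec_eq_iff forall_3 skew_transpose_def vec_lambda_beta s triangular_entries by blast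
qed

text \<open>Read the entries as transitions between states 1, 2, 3: states 1 and 3 loop on every
  letter, state 2 loops on \<open>B\<close>, the letter \<open>a\<close> leads from 1 to 2 and
  \<open>b\<close> from 2 to 3. Entries of a product count paths, and a path from 1 to 3 is a choice
  of a factor \<open>a q b\<close> with \<open>q\<close> over \<open>B\<close>.\<close>

definition detector :: "'a set \<Rightarrow> 'a \<Rightarrow> 'a \<Rightarrow> 'a \<Rightarrow> real^3^3" where
  "detector B a b z = triangular (of_bool (z \<in> B)) (of_bool (z = a)) (of_bool (z = b))"

lemma detector_in_UT3: "detector B a b z \<in> UT3"
  by (simp add: detector_def triangular_in_UT3)

lemma eval_word_detector:
  "eval_word (detector B a b) w $ 3 $ 3 = 1 \<and>
   eval_word (detector B a b) w $ 2 $ 3 = real (prefix_count B b w) \<and>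
   eval_word (detector B a b) w $ 1 $ 3 = real (factor_count B a b w)"
  by (induction w) (simp_all add: mat_def matrix_mult_entry3 detector_def)

lemma UT3_equiv_prefix_count: "UT3_equiv u v \<Longrightarrow> prefix_count B b u = prefix_count B b v"
  using UT3_equivD[of u v "detector B b b", OF _ detector_in_UT3]
    eval_word_detector[of B b b u] eval_word_detector[of B b b v] by simp

lemma UT3_equiv_factor_count: "UT3_equiv u v \<Longrightarrow> factor_count B a b u = factor_count B a b v"
  using UT3_equivD[of u v "detector B a b", OF _ detector_in_UT3]
    eval_word_detector[of B a b u] eval_word_detector[of B a b v] by simp

lemma prefix_count_UNIV: "prefix_count UNIV b w = count_list w b"
  by (induction w) auto

lemma UT3_equiv_count_list: "UT3_equiv u v \<Longrightarrow> count_list u x = count_list v x"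
  using UT3_equiv_prefix_count[of u v UNIV x] by (simp add: prefix_count_UNIV)

lemma UT3_equiv_set: "UT3_equiv u v \<Longrightarrow> set u = set v"
  using UT3_equiv_count_list[of u v] by (auto simp: set_eq_iff) (metis count_list_0_iff)+

lemma factor_count_UNIV_append:
  "factor_count UNIV a b (u @ v) =
   factor_count UNIV a b u + factor_count UNIV a b v + count_list u a * count_list v b"
  by (induction u) (auto simp: prefix_count_UNIV)

lemma factor_count_UNIV_absent: "a \<notin> set w \<or> b \<notin> set w \<Longrightarrow> factor_count UNIV a b w = 0"
  by (induction w) (auto simp: prefix_count_UNIV count_list_0_iff)

text \<open>With \<open>B = UNIV\<close> the gap is unrestricted, so \<open>factor_count\<close>
  counts the occurrences of \<open>x\<close> followed later by \<open>y\<close>. For letters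
  occurring once this number reveals their order.\<close>

lemma UT3_equiv_linear_order:
  assumes eq: "UT3_equiv s t" and s: "s = s1 @ x # s2 @ y # s3" and "x \<noteq> y"
    and one: "count_list s x = 1" "count_list s y = 1"
  obtains t1 t2 t3 where "t = t1 @ x # t2 @ y # t3"
proof -
  have one': "count_list t x = 1" "count_list t y = 1"
    using one UT3_equiv_count_list[OF eq] by metis+
  obtain p q where pq: "t = p @ x # q"
    using one'(1) by (metis count_notin split_list zero_neq_one)
  have x: "x \<notin> set p" "x \<notin> set q" using one'(1) by (auto simp: pq count_list_0_iff)
  have "0 < factor_count UNIV x y s"
    by (simp add: s factor_count_UNIV_append prefix_count_UNIV)
  then have "0 < factor_count UNIV x y t"
    using UT3_equiv_factor_count[OF eq] by metis
  moreover have "factor_count UNIV x y t = count_list q y"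
    using x by (simp add: pq factor_count_UNIV_append factor_count_UNIV_absent prefix_count_UNIV)
  ultimately have "count_list q y \<noteq> 0" by simp
  then obtain q1 q2 where "q = q1 @ y # q2"
    by (metis count_notin split_list)
  with pq that show ?thesis by simp
qed

section \<open>Adjacent pairs and rigid factors\<close>

definition adjacent :: "'a list \<Rightarrow> ('a \<times> 'a) list" where
  "adjacent w = zip w (tl w)"

lemma adjacent_simps [simp]:
  "adjacent [] = []" "adjacent [x] = []" "adjacent (x # y # w) = (x, y) # adjacent (y # w)"
  by (simp_all add: adjacent_def)

lemma length_adjacent [simp]: "length (adjacent w) = length w - 1"
  by (simp add: adjacent_def)

lemma nth_adjacent: "Suc p < length w \<Longrightarrow> adjacent w ! p = (w ! p, w ! Suc p)"
  by (simp add: adjacent_def nth_tl)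

lemma adjacent_append: "adjacent (u @ v) =
   adjacent u @ (if u = [] \<or> v = [] then [] else [(last u, hd v)]) @ adjacent v"
proof (induction u rule: induct_list012)
  case (2 x)
  then show ?case by (cases v) auto
qed auto

lemma adjacent_factor: "set (adjacent v) \<subseteq> set (adjacent (u @ v @ w))"
  by (auto simp: adjacent_append)

lemma nth_adjacent_factor:
  assumes "p < length (adjacent v)"
  shows "length u + p < length (adjacent (u @ v @ w)) \<and>
     adjacent (u @ v @ w) ! (length u + p) = adjacent v ! p"
proof -
  have "Suc p < length v" using assms by simp
  then show ?thesis by (simp add: nth_adjacent nth_append)
qed

lemma set_adjacent_iff: "(a, b) \<in> set (adjacent w) \<longleftrightarrow> (\<exists>u v. w = u @ a # b # v)"
proof
  assume "(a, b) \<in> set (adjacent w)"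
  then obtain p where p: "p < length w - 1" "adjacent w ! p = (a, b)"
    by (auto simp: in_set_conv_nth)
  then have "w = take p w @ a # b # drop (Suc (Suc p)) w"
    by (metis Cons_nth_drop_Suc Suc_lessD append_take_drop_id less_diff_conv nth_adjacent
        Pair_inject Suc_eq_plus1)
  then show "\<exists>u v. w = u @ a # b # v" by blast
next
  assume "\<exists>u v. w = u @ a # b # v"
  then show "(a, b) \<in> set (adjacent w)" by (auto simp: adjacent_append)
qed

lemma count_list_1_member: "count_list xs x = 1 \<Longrightarrow> x \<in> set xs"
  by (metis count_notin zero_neq_one)

lemma count_list_1_nth_unique:
  assumes "count_list xs a = 1" "i < length xs" "j < length xs" "xs ! i = a" "xs ! j = a"
  shows "i = j"
proof -
  have "card {k. k < length xs \<and> xs ! k = a} = 1"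
    using assms(1) by (simp add: count_list_eq_length_filter length_filter_conv_card eq_commute)
  then obtain l where l: "{k. k < length xs \<and> xs ! k = a} = {l}"
    by (auto simp: card_1_singleton_iff)
  have "i \<in> {l}" "j \<in> {l}" unfolding l[symmetric] using assms by auto
  then show ?thesis by simp
qed

text \<open>With no letters allowed in the gap, \<open>a\<close> and \<open>b\<close> must be
  neighbours; this makes the number of occurrences of each adjacent pair an invariant.\<close>

lemma factor_count_empty: "factor_count {} a b w = count_list (adjacent w) (a, b)"
proof (induction w rule: induct_list012)
  case (3 x y zs)
  then show ?case by auto
qed auto

lemma UT3_equiv_count_adjacent:
  "UT3_equiv u v \<Longrightarrow> count_list (adjacent u) p = count_list (adjacent v) p"
  using UT3_equiv_factor_count[of u v "{}" "fst p" "snd p"] by (simp add: factor_count_empty)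

lemma prefix_count_mono: "prefix_count {} b w \<le> prefix_count B b w"
  by (cases w) auto

lemma factor_count_mono: "factor_count {} a b w \<le> factor_count B a b w"
  by (induction w) (auto intro: add_mono prefix_count_mono)

text \<open>The factor \<open>a c b\<close> is counted when \<open>c\<close> may fill the gap, and
  not when the gap must be empty.\<close>

lemma factor_count_less_if_factor:
  "factor_count {} a b (u @ a # c # b # v) < factor_count {c} a b (u @ a # c # b # v)"
proof (induction u)
  case Nil
  then show ?case using factor_count_mono[of a b "c # b # v" "{c}"] by auto
next
  case (Cons z u)
  then show ?case using prefix_count_mono[of b "u @ a # c # b # v" "{c}"] by auto
qed

text \<open>The excess comes from factors consisting of \<open>a\<close>, a positive power of
  \<open>c\<close>, and \<open>b\<close>. Without squares of \<open>c\<close> the power is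
  \<open>c\<close> itself.\<close>

lemma factor_if_factor_count_less:
  "factor_count {} a b w < factor_count {c} a b w \<Longrightarrow> (c, c) \<notin> set (adjacent w) \<Longrightarrow>
   \<exists>u v. w = u @ a # c # b # v"
proof (induction w)
  case (Cons z w)
  show ?case
  proof (cases "factor_count {} a b w < factor_count {c} a b w")
    case True
    have "(c, c) \<notin> set (adjacent w)"
      using Cons.prems(2) adjacent_factor[of w "[z]" "[]"] by auto
    with True Cons.IH obtain u v where "w = u @ a # c # b # v" by blast
    then show ?thesis by (metis append_Cons)
  next
    \<comment> \<open>The tail contributes no excess, so the additional factor starts at the first
      letter \<open>z\<close>.\<close>
    case False
    then have z: "z = a" and *: "prefix_count {} b w < prefix_count {c} b w"
      using Cons.prems(1) by (cases "z = a"; simp)+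
    from * obtain w' where w: "w = c # w'" and **: "prefix_count {c} b w' > 0"
      by (cases w) (auto split: if_splits)
    from ** obtain y v where y: "w' = y # v" "y = b \<or> y = c"
      by (cases w') auto
    with Cons.prems(2) have "y = b" by (auto simp: z w adjacent_append split: list.splits)
    then show ?thesis using z w y by (metis append_Nil)
  qed
qed simp

section \<open>Rigid factors, which survive in every equivalent word\<close>

definition rigid :: "'a list \<Rightarrow> 'a list \<Rightarrow> bool" where
  "rigid E w \<longleftrightarrow> (\<exists>u v. w = u @ E @ v) \<and> 2 \<le> length E \<and>
     (\<forall>p\<in>set (adjacent E). count_list (adjacent w) p = 1) \<and>
     (\<forall>i. 0 < i \<and> Suc i < length E \<longrightarrow> (E ! i, E ! i) \<notin> set (adjacent w))"

text \<open>The prefixes of \<open>E\<close> are found in \<open>w'\<close> by induction on their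
  length. If a prefix ends in \<open>a c\<close>, the three-letter factor \<open>a c b\<close> of
  \<open>E\<close> also occurs in \<open>w'\<close> by the counting argument with gap letter
  \<open>c\<close>. Both contain the pair \<open>(a, c)\<close>, which occurs once in
  \<open>w'\<close>, so they overlap there and the prefix extends by \<open>b\<close>.\<close>

lemma UT3_equiv_rigid:
  assumes eq: "UT3_equiv w w'" and r: "rigid E w"
  shows "rigid E w'"
proof -
  have one: "count_list (adjacent w') p = 1" if "p \<in> set (adjacent E)" for p
    using r that UT3_equiv_count_adjacent[OF eq] by (simp add: rigid_def)
  have none: "(E ! i, E ! i) \<notin> set (adjacent w')" if "0 < i" "Suc i < length E" for i
    using r that UT3_equiv_count_adjacent[OF eq] unfolding rigid_def by (metis count_list_0_iff)
  have len: "2 \<le> length E" using r by (simp add: rigid_def)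
  obtain u v where w: "w = u @ E @ v" using r unfolding rigid_def by blast
  have pair: "(E ! i, E ! Suc i) \<in> set (adjacent E)" if "Suc i < length E" for i
    using that nth_adjacent[of i E] by (metis length_adjacent less_diff_conv nth_mem Suc_eq_plus1)
  have "\<exists>u' v'. w' = u' @ take n E @ v'" if "2 \<le> n" "n \<le> length E" for n
    using that
  proof (induction n rule: dec_induct)
    case base
    have "(E ! 0, E ! Suc 0) \<in> set (adjacent w')"
      using one[OF pair[of 0]] len by (intro count_list_1_member) simp
    moreover have "take 2 E = [E ! 0, E ! Suc 0]"
      using len by (cases E; cases "tl E") auto
    ultimately show ?case by (auto simp: set_adjacent_iff)
  next
    case (step n)
    then obtain k where n: "n = Suc (Suc k)" by (metis add_2_eq_Suc le_Suc_ex)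
    define a b c where abc: "a = E ! k" "b = E ! Suc (Suc k)" "c = E ! Suc k"
    have E: "E = take k E @ a # c # b # drop (Suc n) E"
      using step.prems n abc by (metis Cons_nth_drop_Suc Suc_le_lessD Suc_lessD append_take_drop_id)
    have c: "(c, c) \<notin> set (adjacent w')"
      using none[of "Suc k"] step.prems by (simp add: abc n)
    have "w = (u @ take k E) @ a # c # b # (drop (Suc n) E @ v)"
      by (subst w, subst E) simp
    then have "factor_count {} a b w < factor_count {c} a b w"
      using factor_count_less_if_factor by metis
    then have "factor_count {} a b w' < factor_count {c} a b w'"
      using UT3_equiv_factor_count[OF eq] by metis
    then obtain p q where pq: "w' = p @ a # c # b # q"
      using factor_if_factor_count_less c by metis
    obtain u' v' where uv: "w' = u' @ take n E @ v'" using step by auto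
    have tk: "take n E = take k E @ [a, c]"
      using step.prems by (simp add: n abc take_Suc_conv_app_nth)
    let ?p' = "u' @ take k E"
    have uv': "w' = ?p' @ a # c # v'" using uv tk by simp
    have "adjacent w' ! length p = (a, c)" "length p < length (adjacent w')"
      using nth_adjacent_factor[of 0 "[a, c]" p "b # q"] pq by simp_all
    moreover have "adjacent w' ! length ?p' = (a, c)" "length ?p' < length (adjacent w')"
      using nth_adjacent_factor[of 0 "[a, c]" ?p' v'] uv' by simp_all
    moreover have "count_list (adjacent w') (a, c) = 1"
      using one[OF pair[of k]] step.prems by (simp add: abc n)
    ultimately have "length p = length ?p'" by (metis count_list_1_nth_unique)
    then have "v' = b # q" using pq uv' by (metis append_eq_append_conv list.inject)
    moreover have "take (Suc n) E = take n E @ [b]"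
      using step.prems by (simp add: n abc take_Suc_conv_app_nth)
    ultimately show ?case using uv by auto
  qed
  from this[of "length E"] len have "\<exists>u' v'. w' = u' @ E @ v'" by simp
  with one none len show ?thesis by (simp add: rigid_def)
qed

section \<open>The relative order of two rigid factors\<close>

text \<open>The case \<open>p = q\<close> is allowed and then means that the pair occurs at least
  twice.\<close>

definition occurs_before :: "'a \<times> 'a \<Rightarrow> 'a \<times> 'a \<Rightarrow> 'a list \<Rightarrow> bool" where
  "occurs_before p q w \<longleftrightarrow>
     (\<exists>i j. i < j \<and> j < length (adjacent w) \<and> adjacent w ! i = p \<and> adjacent w ! j = q)"

lemma occurs_before_factor: "occurs_before p q v \<Longrightarrow> occurs_before p q (u @ v @ w)"
  unfolding occurs_before_def using nth_adjacent_factor[of _ v u w]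
  by (meson add_less_cancel_left less_trans)

lemma occurs_before_append:
  assumes "p \<in> set (adjacent u)" "q \<in> set (adjacent v)"
  shows "occurs_before p q (a @ u @ b @ v @ c)"
proof -
  obtain i j where ij: "i < length (adjacent u)" "adjacent u ! i = p"
      "j < length (adjacent v)" "adjacent v ! j = q"
    using assms by (auto simp: in_set_conv_nth)
  have "adjacent (a @ u @ b @ v @ c) ! (length a + i) = p"
    using nth_adjacent_factor[OF ij(1), of a "b @ v @ c"] ij by simp
  moreover have "adjacent ((a @ u @ b) @ v @ c) ! (length (a @ u @ b) + j) = q"
    "length (a @ u @ b) + j < length (adjacent ((a @ u @ b) @ v @ c))"
    using nth_adjacent_factor[OF ij(3), of "a @ u @ b" c] ij by auto
  moreover have "length a + i < length (a @ u @ b) + j" using ij(1) by simp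
  ultimately show ?thesis unfolding occurs_before_def append_assoc by blast
qed

lemma occurs_before_asym:
  assumes "occurs_before p q w" "occurs_before q p w"
    "count_list (adjacent w) p = 1" "count_list (adjacent w) q = 1"
  shows False
  using assms count_list_1_nth_unique unfolding occurs_before_def
  by (metis less_asym less_trans)

text \<open>The positions of the pairs of a rigid factor form an interval, and the intervals of two
  rigid factors without a common pair are disjoint.\<close>

lemma occurs_before_rigid:
  assumes r: "rigid E w" "rigid D w" and disj: "set (adjacent E) \<inter> set (adjacent D) = {}"
    and p: "p \<in> set (adjacent E)" "p' \<in> set (adjacent E)"
    and q: "q \<in> set (adjacent D)" "q' \<in> set (adjacent D)"
    and bef: "occurs_before p q w"
  shows "occurs_before p' q' w"
proof -
  obtain u1 v1 u2 v2 where w: "w = u1 @ E @ v1" "w = u2 @ D @ v2"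
    using r unfolding rigid_def by blast
  define e d where ed: "e = length u1" "d = length u2"
  have E: "e + i < length (adjacent w) \<and> adjacent w ! (e + i) = adjacent E ! i"
    if "i < length (adjacent E)" for i
    using nth_adjacent_factor[OF that, of u1 v1, folded w(1) ed(1)] .
  have D: "d + i < length (adjacent w) \<and> adjacent w ! (d + i) = adjacent D ! i"
    if "i < length (adjacent D)" for i
    using nth_adjacent_factor[OF that, of u2 v2, folded w(2) ed(2)] .
  have ne: "e + i \<noteq> d + j" if "i < length (adjacent E)" "j < length (adjacent D)" for i j
    using E[OF that(1)] D[OF that(2)] disj nth_mem[OF that(1)] nth_mem[OF that(2)] by auto
  obtain i i' j j' where ij: "i < length (adjacent E)" "adjacent E ! i = p"
      "i' < length (adjacent E)" "adjacent E ! i' = p'"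
      "j < length (adjacent D)" "adjacent D ! j = q"
      "j' < length (adjacent D)" "adjacent D ! j' = q'"
    using p q by (auto simp: in_set_conv_nth)
  obtain k l where kl: "k < l" "l < length (adjacent w)" "adjacent w ! k = p" "adjacent w ! l = q"
    using bef unfolding occurs_before_def by blast
  have "count_list (adjacent w) p = 1" "count_list (adjacent w) q = 1"
    using r p q unfolding rigid_def by blast+
  then have "k = e + i" "l = d + j"
    using E[OF ij(1)] D[OF ij(5)] ij kl count_list_1_nth_unique
    by (metis less_trans)+
  with kl have lt: "e + i < d + j" by simp
  have "e + i' < d + j'"
  proof (rule ccontr)
    assume "\<not> e + i' < d + j'"
    then have ge: "d + j' \<le> e + i'" by simp
    show False
    \<comment> \<open>Whichever interval starts later, its first position lies in the other one as
      well, contradicting \<open>ne\<close>.\<close>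
    proof (cases "e \<le> d")
      case True
      then have "d - e < length (adjacent E)" "0 < length (adjacent D)"
        using ge ij by linarith+
      then show False using ne[of "d - e" 0] True by simp
    next
      case False
      then have "0 < length (adjacent E)" "e - d < length (adjacent D)"
        using lt ij by linarith+
      then show False using ne[of 0 "e - d"] False by simp
    qed
  qed
  then show ?thesis
    unfolding occurs_before_def using E[OF ij(3)] D[OF ij(7)] ij by blast
qed

text \<open>At most \<open>length s\<close> pairs arise at the boundaries of the images of the letters.\<close>

lemma card_boundary_pairs:
  "card (set (adjacent (concat (map \<phi> s))) - (\<Union>x\<in>set s. set (adjacent (\<phi> x)))) \<le> length s"
proof (induction s)
  case (Cons z s)
  let ?A = "set (adjacent (concat (map \<phi> s)))" and ?B = "\<Union>x\<in>set s. set (adjacent (\<phi> x))"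
  have "set (adjacent (concat (map \<phi> (z # s)))) - (\<Union>x\<in>set (z # s). set (adjacent (\<phi> x)))
      \<subseteq> insert (last (\<phi> z), hd (concat (map \<phi> s))) (?A - ?B)"
    by (auto simp: adjacent_append split: if_splits)
  then have "card (set (adjacent (concat (map \<phi> (z # s)))) -
      (\<Union>x\<in>set (z # s). set (adjacent (\<phi> x))))
      \<le> card (insert (last (\<phi> z), hd (concat (map \<phi> s))) (?A - ?B))"
    by (rule card_mono[rotated]) simp
  also have "\<dots> \<le> Suc (card (?A - ?B))" by (rule card_insert_le_m1) simp_all
  finally show ?case using Cons by simp
qed simp

text \<open>Pigeonhole: the distinct word \<open>E\<close> has more than \<open>length s\<close>
  distinct adjacent pairs, while at most \<open>length s\<close> pairs of the image lie in no value
  of a letter.\<close>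

lemma ex_pair_in_image:
  assumes "concat (map \<phi> s) = u @ E @ v" "distinct E" "Suc (length s) < length E"
  obtains x p where "x \<in> set s" "p \<in> set (adjacent E)" "p \<in> set (adjacent (\<phi> x))"
proof (rule ccontr)
  assume "\<not> thesis"
  then have "set (adjacent E) \<subseteq>
      set (adjacent (concat (map \<phi> s))) - (\<Union>x\<in>set s. set (adjacent (\<phi> x)))"
    using that adjacent_factor[of E u v] assms(1) by auto
  then have "card (set (adjacent E)) \<le> length s"
    using card_boundary_pairs[of \<phi> s] by (meson List.finite_set card_mono finite_Diff le_trans)
  moreover have "distinct (adjacent E)"
    unfolding adjacent_def by (rule distinct_zipI1) fact
  ultimately show False using assms(3) by (simp add: distinct_card)
qed

text \<open>A second occurrence of \<open>x\<close> in \<open>s\<close> would repeat every pair of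
  \<open>\<phi> x\<close>.\<close>

lemma linear_if_unique_pair:
  assumes "x \<in> set s" "p \<in> set (adjacent (\<phi> x))"
    and one: "count_list (adjacent (concat (map \<phi> s))) p = 1"
  shows "count_list s x = 1"
proof (rule ccontr)
  assume "count_list s x \<noteq> 1"
  obtain s1 s2 where s: "s = s1 @ x # s2" using assms(1) by (meson split_list)
  with \<open>count_list s x \<noteq> 1\<close> have "x \<in> set s1 \<or> x \<in> set s2"
    by (auto simp: count_list_0_iff)
  then have "\<exists>a b c. s = a @ x # b @ x # c"
    using s by (metis append.assoc append_Cons split_list)
  then obtain a b c where s': "s = a @ x # b @ x # c" by blast
  have "occurs_before p p (concat (map \<phi> s))"
    using occurs_before_append[OF assms(2,2)] by (simp add: s')
  then show False using one occurs_before_asym by metis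
qed

text \<open>Each rigid factor has a pair inside the value of a letter, \<open>x\<close> or
  \<open>y\<close>, occurring once in \<open>s\<close>. If \<open>x = y\<close>, the order of the
  two pairs is fixed inside \<open>\<phi> x\<close>, which is also a factor of the new word.
  Otherwise it is the order of \<open>x\<close> and \<open>y\<close>, which \<open>t\<close> shares
  with \<open>s\<close>.\<close>

lemma subst_preserves_order:
  fixes \<phi> :: "'a \<Rightarrow> 'b list"
  assumes st: "UT3_equiv s t" and r: "rigid E (concat (map \<phi> s))" "rigid D (concat (map \<phi> s))"
    and disj: "set (adjacent E) \<inter> set (adjacent D) = {}"
    and dist: "distinct E" "distinct D"
    and len: "Suc (length s) < length E" "Suc (length s) < length D"
    and pq: "p \<in> set (adjacent E)" "q \<in> set (adjacent D)"
    and bef: "occurs_before p q (concat (map \<phi> s))"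
  shows "occurs_before p q (concat (map \<phi> t))"
proof -
  let ?w = "concat (map \<phi> s)" and ?w' = "concat (map \<phi> t)"
  have r': "rigid E ?w'" "rigid D ?w'"
    using r UT3_equiv_rigid UT3_equiv_subst[OF st, of "[]" \<phi> "[]"] by auto
  obtain x p' where x: "x \<in> set s" "p' \<in> set (adjacent E)" "p' \<in> set (adjacent (\<phi> x))"
    using r(1) dist(1) len(1) unfolding rigid_def by (metis ex_pair_in_image)
  obtain y q' where y: "y \<in> set s" "q' \<in> set (adjacent D)" "q' \<in> set (adjacent (\<phi> y))"
    using r(2) dist(2) len(2) unfolding rigid_def by (metis ex_pair_in_image)
  \<comment> \<open>The given pairs may lie on boundaries between values. They are exchanged for
    \<open>p'\<close> and \<open>q'\<close>, which lie inside values, and exchanged back at the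
    end.\<close>
  have bef': "occurs_before p' q' ?w"
    using occurs_before_rigid[OF r disj] pq x y bef by blast
  have one: "count_list (adjacent ?w) p' = 1" "count_list (adjacent ?w) q' = 1"
    using r x y by (auto simp: rigid_def)
  have lin: "count_list s x = 1" "count_list s y = 1"
    using linear_if_unique_pair x y one by metis+
  have "occurs_before p' q' ?w'"
  proof (cases "x = y")
    case True
    have "occurs_before p' q' (\<phi> x)"
    proof -
      obtain i j where ij: "i < length (adjacent (\<phi> x))" "adjacent (\<phi> x) ! i = p'"
          "j < length (adjacent (\<phi> x))" "adjacent (\<phi> x) ! j = q'"
        using x y True by (auto simp: in_set_conv_nth)
      have "\<not> occurs_before q' p' (\<phi> x)"
      proof
        assume *: "occurs_before q' p' (\<phi> x)"
        obtain s1 s2 where "s = s1 @ x # s2" using x(1) by (meson split_list)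
        with occurs_before_factor[OF *, of "concat (map \<phi> s1)" "concat (map \<phi> s2)"]
        have "occurs_before q' p' ?w" by simp
        with bef' one show False using occurs_before_asym by metis
      qed
      moreover have "i \<noteq> j" using ij x y disj by auto
      ultimately show ?thesis unfolding occurs_before_def using ij by (metis linorder_neqE_nat)
    qed
    moreover obtain t1 t2 where "t = t1 @ x # t2"
      using x(1) UT3_equiv_set[OF st] by (metis split_list)
    ultimately show ?thesis
      using occurs_before_factor[of p' q' "\<phi> x" "concat (map \<phi> t1)" "concat (map \<phi> t2)"] by simp
  next
    case False
    obtain s1 s2 where s: "s = s1 @ x # s2" using x(1) by (meson split_list)
    have "y \<in> set s2"
    proof (rule ccontr)
      assume "y \<notin> set s2"
      with s y False have "y \<in> set s1" by simp
      then obtain a b where "s1 = a @ y # b" by (meson split_list)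
      with s have "occurs_before q' p' ?w"
        using occurs_before_append[OF y(3) x(3)] by simp
      with bef' one show False using occurs_before_asym by metis
    qed
    then obtain b c where "s = s1 @ x # b @ y # c" using s by (metis split_list)
    then obtain t1 t2 t3 where "t = t1 @ x # t2 @ y # t3"
      using UT3_equiv_linear_order[OF st _ False lin] by metis
    then show ?thesis using occurs_before_append[OF x(3) y(3)] by simp
  qed
  then show ?thesis using occurs_before_rigid[OF r' disj] pq x y by blast
qed

section \<open>A nontrivial identity\<close>

lemma UT3_mult_diagonal: "M \<in> UT3 \<Longrightarrow> N \<in> UT3 \<Longrightarrow> (M ** N) $ i $ i = M $ i $ i * N $ i $ i"
  using exhaust_3[of i] by (auto simp: UT3_iff matrix_mult_entry3)

lemma eval_word_diagonal:
  assumes "\<And>x. m x \<in> UT3"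
  shows "eval_word m w $ i $ i = prod_list (map (\<lambda>x. m x $ i $ i) w)"
proof (induction w)
  case Nil
  then show ?case by (simp add: mat_def)
next
  case (Cons x w)
  then show ?case using assms by (simp add: UT3_mult_diagonal eval_word_in_UT3)
qed

lemma eval_word_diagonal_mset:
  assumes "\<And>x. m x \<in> UT3" "mset u = mset v"
  shows "eval_word m u $ i $ i = eval_word m v $ i $ i"
proof -
  have "mset (map (\<lambda>x. m x $ i $ i) u) = mset (map (\<lambda>x. m x $ i $ i) v)"
    using assms(2) by simp
  then show ?thesis unfolding eval_word_diagonal[OF assms(1)] by (simp only: prod_mset_prod_list[symmetric])
qed

text \<open>Diagonal entries are 0 or 1, so a product with unit diagonal has only unitriangular
  factors, and on these the entries (1,2) and (2,3) are additive. They thus depend only on the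
  multiset of letters.\<close>

lemma eval_word_superdiagonal:
  assumes m: "\<And>x. m x \<in> UT3"
  shows "(\<forall>i. eval_word m w $ i $ i = 1) \<Longrightarrow>
    eval_word m w $ 1 $ 2 = sum_list (map (\<lambda>x. m x $ 1 $ 2) w) \<and>
    eval_word m w $ 2 $ 3 = sum_list (map (\<lambda>x. m x $ 2 $ 3) w)"
proof (induction w)
  case Nil
  then show ?case by (simp add: mat_def)
next
  case (Cons x w)
  have w: "eval_word m w \<in> UT3" by (simp add: m eval_word_in_UT3)
  have *: "m x $ i $ i * eval_word m w $ i $ i = 1" for i
    using Cons.prems UT3_mult_diagonal[OF m w] by simp
  have "M = 1 \<and> N = 1" if "M \<in> {0, 1}" "N \<in> {0, 1}" "M * N = 1" for M N :: real
    using that by auto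
  then have d: "m x $ i $ i = 1 \<and> eval_word m w $ i $ i = 1" for i
    using m[of x] w * unfolding UT3_def by blast
  then have "eval_word m w $ 1 $ 2 = sum_list (map (\<lambda>x. m x $ 1 $ 2) w)"
    "eval_word m w $ 2 $ 3 = sum_list (map (\<lambda>x. m x $ 2 $ 3) w)"
    using Cons.IH by blast+
  then show ?case using d m[of x] w by (simp add: matrix_mult_entry3 UT3_iff)
qed

lemma eval_word_superdiagonal_mset:
  assumes m: "\<And>x. m x \<in> UT3" and uv: "mset u = mset v"
    and one: "\<forall>i. eval_word m u $ i $ i = 1"
  shows "eval_word m u $ 1 $ 2 = eval_word m v $ 1 $ 2"
    "eval_word m u $ 2 $ 3 = eval_word m v $ 2 $ 3"
proof -
  have one': "\<forall>i. eval_word m v $ i $ i = 1"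
    using one eval_word_diagonal_mset[OF m uv] by simp
  have "sum_list (map (\<lambda>x. m x $ i $ j) u) = sum_list (map (\<lambda>x. m x $ i $ j) v)" for i j
    using uv by (simp only: sum_mset_sum_list[symmetric] mset_map)
  then show "eval_word m u $ 1 $ 2 = eval_word m v $ 1 $ 2"
    "eval_word m u $ 2 $ 3 = eval_word m v $ 2 $ 3"
    using eval_word_superdiagonal[OF m one] eval_word_superdiagonal[OF m one'] by simp_all
qed

text \<open>If some diagonal entry vanishes, the entries of the product only involve \<open>X\<close> and \<open>Y\<close>
  through their neighbours \<open>F\<close>. Otherwise the two products differ by a commutator of matrices
  that agree modulo the centre of the unitriangular group.\<close>

lemma UT3_sandwich_swap:
  assumes "F \<in> UT3" "X \<in> UT3" "Y \<in> UT3"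
    and "\<And>i. X $ i $ i = F $ i $ i" "\<And>i. Y $ i $ i = F $ i $ i"
    and "(\<forall>i. F $ i $ i = 1) \<Longrightarrow> X $ 1 $ 2 = F $ 1 $ 2 \<and> Y $ 1 $ 2 = F $ 1 $ 2 \<and>
      X $ 2 $ 3 = F $ 2 $ 3 \<and> Y $ 2 $ 3 = F $ 2 $ 3"
  shows "F ** (F ** (X ** (F ** (Y ** (F ** F))))) = F ** (F ** (Y ** (F ** (X ** (F ** F)))))"
proof -
  have z: "M $ 2 $ 1 = 0" "M $ 3 $ 1 = 0" "M $ 3 $ 2 = 0" if "M \<in> UT3" for M
    using that by (simp_all add: UT3_iff)
  note z' = assms(4,5) z[OF assms(1)] z[OF assms(2)] z[OF assms(3)]
  have c: "F$1$1 = 0 \<or> F$1$1 = 1" "F$2$2 = 0 \<or> F$2$2 = 1" "F$3$3 = 0 \<or> F$3$3 = 1"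
    using assms(1) by (simp_all add: UT3_iff)
  have o: "X$1$2 = F$1$2 \<and> Y$1$2 = F$1$2 \<and> X$2$3 = F$2$3 \<and> Y$2$3 = F$2$3"
    if "F$1$1 = 1" "F$2$2 = 1" "F$3$3 = 1"
    using that assms(6) by (simp add: forall_3)
  show ?thesis
  proof (cases "F$1$1 = 1 \<and> F$2$2 = 1 \<and> F$3$3 = 1")
    case True
    then show ?thesis using o
      by (simp add: vec_eq_iff forall_3 matrix_mult_entry3 z' algebra_simps)
  next
    case False
    then show ?thesis using c
      by (elim disjE) (simp_all add: vec_eq_iff forall_3 matrix_mult_entry3 z' algebra_simps)
  qed
qed

definition sandwich :: "'a list \<Rightarrow> 'a list \<Rightarrow> 'a list \<Rightarrow> 'a list" where
  "sandwich f X Y = f @ f @ X @ f @ Y @ f @ f"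

lemma UT3_equiv_sandwich:
  assumes X: "mset X = mset f" and Y: "mset Y = mset f"
  shows "UT3_equiv (sandwich f X Y) (sandwich f Y X)"
  unfolding UT3_equiv_def
proof (intro allI impI)
  fix m :: "'a \<Rightarrow> real^3^3" assume "range m \<subseteq> UT3"
  then have m: "m x \<in> UT3" for x by auto
  show "eval_word m (sandwich f X Y) = eval_word m (sandwich f Y X)"
    unfolding sandwich_def eval_word_append
  proof (rule UT3_sandwich_swap)
    assume one: "\<forall>i. eval_word m f $ i $ i = 1"
    show "eval_word m X $ 1 $ 2 = eval_word m f $ 1 $ 2 \<and>
        eval_word m Y $ 1 $ 2 = eval_word m f $ 1 $ 2 \<and>
        eval_word m X $ 2 $ 3 = eval_word m f $ 2 $ 3 \<and>
        eval_word m Y $ 2 $ 3 = eval_word m f $ 2 $ 3"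
      using eval_word_superdiagonal_mset[OF m X[symmetric] one]
        eval_word_superdiagonal_mset[OF m Y[symmetric] one] by simp
  qed (simp_all add: m eval_word_in_UT3 eval_word_diagonal_mset[OF m X]
        eval_word_diagonal_mset[OF m Y])
qed

section \<open>The concrete blocks and their adjacent pairs\<close>

definition evens :: "nat \<Rightarrow> nat list" where "evens n = map (\<lambda>i. 2 * i) [0..<n]"
definition odds :: "nat \<Rightarrow> nat list" where "odds n = map (\<lambda>i. Suc (2 * i)) [0..<n]"
definition descent :: "nat \<Rightarrow> nat list" where "descent n = map (\<lambda>i. 2 * n - Suc i) [0..<2 * n]"

lemma distinct_evens: "distinct (evens n)" and distinct_descent: "distinct (descent n)"
  by (auto simp: evens_def descent_def distinct_map inj_on_def)

lemma mset_evens_odds: "mset (evens n @ odds n) = mset [0..<2 * n]"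
proof (rule iffD1[OF set_eq_iff_mset_eq_distinct])
  show "distinct (evens n @ odds n)"
    by (auto simp: evens_def odds_def distinct_map inj_on_def) presburger
  have "x \<in> (\<lambda>i. 2 * i) ` {0..<n} \<union> (\<lambda>i. Suc (2 * i)) ` {0..<n}" if "x < 2 * n" for x
    using that by (cases "even x") (auto elim!: evenE oddE)
  then have "{0..<2 * n} \<subseteq> (\<lambda>i. 2 * i) ` {0..<n} \<union> (\<lambda>i. Suc (2 * i)) ` {0..<n}"
    by (intro subsetI) simp
  moreover have "(\<lambda>i. 2 * i) ` {0..<n} \<union> (\<lambda>i. Suc (2 * i)) ` {0..<n} \<subseteq> {0..<2 * n}"
    by auto
  ultimately show "set (evens n @ odds n) = set [0..<2 * n]"
    unfolding evens_def odds_def set_append set_map set_upt by (rule subset_antisym[rotated])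
qed simp

lemma mset_descent: "mset (descent n) = mset [0..<2 * n]"
proof -
  have "descent n = rev [0..<2 * n]"
    by (rule nth_equalityI) (simp_all add: descent_def rev_nth)
  then show ?thesis by simp
qed

lemma adjacent_map_upt:
  "adjacent (map g [0..<n]) = map (\<lambda>i. (g i, g (Suc i))) [0..<n - 1]"
  by (rule nth_equalityI) (simp_all add: nth_adjacent)

lemma count_list_distinct: "distinct xs \<Longrightarrow> x \<in> set xs \<Longrightarrow> count_list xs x = 1"
  by (induction xs) auto

text \<open>The pairs are kept as a list because rigidity needs multiplicities. Nonempty blocks
  ensure that every boundary contributes a pair.\<close>

lemma adjacent_sandwich:
  assumes "0 < n"
  shows "adjacent (sandwich [0..<2 * n] (evens n @ odds n) (descent n)) =
    adjacent [0..<2*n] @ (2*n - 1, 0) # adjacent [0..<2*n] @ (2*n - 1, 0) #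
    adjacent (evens n) @ (2*n - 2, 1) # adjacent (odds n) @ (2*n - 1, 0) #
    adjacent [0..<2*n] @ (2*n - 1, 2*n - 1) # adjacent (descent n) @ (0, 0) #
    adjacent [0..<2*n] @ (2*n - 1, 0) # adjacent [0..<2*n]"
proof -
  have h: "hd (evens n) = 0" "hd (odds n) = 1" "hd (descent n) = 2*n - 1" "hd [0..<2*n] = 0"
    using assms by (simp_all add: evens_def odds_def descent_def hd_map)
  have l: "last (evens n) = 2*n - 2" "last (odds n) = 2*n - 1" "last (descent n) = 0"
      "last [0..<2*n] = 2*n - 1"
    using assms by (simp_all add: evens_def odds_def descent_def last_map)
  have ne: "evens n \<noteq> []" "odds n \<noteq> []" "descent n \<noteq> []" "[0..<2*n] \<noteq> []"
    using assms by (simp_all add: evens_def odds_def descent_def)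
  show ?thesis
    unfolding sandwich_def append_assoc using assms
    by (simp add: adjacent_append h l ne del: upt_conv_Nil)
qed

text \<open>The blocks are told apart by the step from one entry to the next, which is 1, 2, 2 or
  -1, and the two blocks with step 2 by parity.\<close>

lemma adjacent_blocks:
  "set (adjacent [0..<n]) = {(i, Suc i) |i. Suc i < n}"
  "set (adjacent (evens n)) = {(2 * i, 2 * i + 2) |i. Suc i < n}"
  "set (adjacent (odds n)) = {(2 * i + 1, 2 * i + 3) |i. Suc i < n}"
  "set (adjacent (descent n)) = {(Suc i, i) |i. Suc i < 2 * n}"
proof -
  show "set (adjacent [0..<n]) = {(i, Suc i) |i. Suc i < n}"
    using adjacent_map_upt[of "\<lambda>i. i" n] by auto
  show "set (adjacent (evens n)) = {(2 * i, 2 * i + 2) |i. Suc i < n}"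
    unfolding evens_def adjacent_map_upt by auto
  show "set (adjacent (odds n)) = {(2 * i + 1, 2 * i + 3) |i. Suc i < n}"
    unfolding odds_def adjacent_map_upt by auto
  have "(Suc i, i) \<in> (\<lambda>i. (2 * n - Suc i, 2 * n - Suc (Suc i))) ` {0..<2 * n - 1}"
    if "Suc i < 2 * n" for i
    by (rule image_eqI[of _ _ "2 * n - Suc (Suc i)"]) (use that in auto)
  then show "set (adjacent (descent n)) = {(Suc i, i) |i. Suc i < 2 * n}"
    unfolding descent_def adjacent_map_upt by auto
qed

lemma evens_descent_disjoint: "set (adjacent (evens n)) \<inter> set (adjacent (descent n)) = {}"
  by (auto simp: adjacent_blocks)

text \<open>Squares arise only at the two ends of the descending block, at \<open>2 * n - 1\<close>
  and at 0. The inner letters of both rigid blocks avoid these values.\<close>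

lemma no_squares_in_sandwich:
  assumes "0 < n" "0 < c" "c < 2 * n - 1"
  shows "(c, c) \<notin> set (adjacent (sandwich [0..<2 * n] (evens n @ odds n) (descent n)))"
  using assms by (auto simp: adjacent_sandwich adjacent_blocks) presburger

lemma rigid_evens:
  assumes n: "3 \<le> n"
  shows "rigid (evens n) (sandwich [0..<2 * n] (evens n @ odds n) (descent n))"
  unfolding rigid_def
proof (intro conjI allI impI ballI)
  let ?w = "sandwich [0..<2 * n] (evens n @ odds n) (descent n)"
  have "?w = ([0..<2 * n] @ [0..<2 * n]) @ evens n @
      (odds n @ [0..<2 * n] @ descent n @ [0..<2 * n] @ [0..<2 * n])"
    by (simp add: sandwich_def)
  then show "\<exists>u v. ?w = u @ evens n @ v" by blast
  show "2 \<le> length (evens n)" using n by (simp add: evens_def)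
  fix p assume p: "p \<in> set (adjacent (evens n))"
  then have "count_list (adjacent (evens n)) p = 1"
    by (intro count_list_distinct) (simp_all add: adjacent_def distinct_zipI1 distinct_evens)
  moreover have "p \<notin> set (adjacent [0..<2 * n])" "p \<notin> set (adjacent (odds n))"
    "p \<notin> set (adjacent (descent n))"
    using p by (auto simp: adjacent_blocks; presburger)+
  moreover have "p \<noteq> (2*n - 1, 0)" "p \<noteq> (2*n - 2, 1)" "p \<noteq> (2*n - 1, 2*n - 1)" "p \<noteq> (0, 0)"
    using p by (auto simp: adjacent_blocks)
  ultimately show "count_list (adjacent ?w) p = 1"
    using n by (simp add: adjacent_sandwich)
next
  fix i assume "0 < i \<and> Suc i < length (evens n)"
  then show "(evens n ! i, evens n ! i) \<notin>
      set (adjacent (sandwich [0..<2 * n] (evens n @ odds n) (descent n)))"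
    by (intro no_squares_in_sandwich) (auto simp: evens_def)
qed

lemma rigid_descent:
  assumes n: "3 \<le> n"
  shows "rigid (descent n) (sandwich [0..<2 * n] (evens n @ odds n) (descent n))"
  unfolding rigid_def
proof (intro conjI allI impI ballI)
  let ?w = "sandwich [0..<2 * n] (evens n @ odds n) (descent n)"
  have "?w = ([0..<2 * n] @ [0..<2 * n] @ (evens n @ odds n) @ [0..<2 * n]) @ descent n @
      ([0..<2 * n] @ [0..<2 * n])"
    by (simp add: sandwich_def)
  then show "\<exists>u v. ?w = u @ descent n @ v" by blast
  show "2 \<le> length (descent n)" using n by (simp add: descent_def)
  fix p assume p: "p \<in> set (adjacent (descent n))"
  then have "count_list (adjacent (descent n)) p = 1"
    by (intro count_list_distinct) (simp_all add: adjacent_def distinct_zipI1 distinct_descent)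
  moreover have "p \<notin> set (adjacent [0..<2 * n])" "p \<notin> set (adjacent (odds n))"
    "p \<notin> set (adjacent (evens n))"
    using p by (auto simp: adjacent_blocks)
  \<comment> \<open>For \<open>n = 2\<close> the boundary pair \<open>(2*n - 2, 1)\<close> would be
    \<open>(2, 1)\<close>, a pair of the descending block; the bound on \<open>n\<close> excludes
    this.\<close>
  moreover have "p \<noteq> (2*n - 1, 0)" "p \<noteq> (2*n - 2, 1)" "p \<noteq> (2*n - 1, 2*n - 1)" "p \<noteq> (0, 0)"
    using p n by (auto simp: adjacent_blocks)
  ultimately show "count_list (adjacent ?w) p = 1"
    using n by (simp add: adjacent_sandwich)
next
  fix i assume "0 < i \<and> Suc i < length (descent n)"
  then show "(descent n ! i, descent n ! i) \<notin>
      set (adjacent (sandwich [0..<2 * n] (evens n @ odds n) (descent n)))"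
    by (intro no_squares_in_sandwich) (auto simp: descent_def)
qed

section \<open>A property of words preserved by short identities\<close>

text \<open>The pair \<open>(0, 2)\<close> opens the block of even letters and \<open>(1, 0)\<close>
  closes the descending block; their order stands for the order of the blocks.\<close>

definition good_word :: "nat \<Rightarrow> nat list \<Rightarrow> bool" where
  "good_word n w \<longleftrightarrow> UT3_equiv (sandwich [0..<2 * n] (evens n @ odds n) (descent n)) w \<and>
     occurs_before (0, 2) (1, 0) w"

lemma good_word_sandwich:
  assumes "3 \<le> n"
  shows "good_word n (sandwich [0..<2 * n] (evens n @ odds n) (descent n))"
proof -
  have "(0, 2) \<in> set (adjacent (evens n))" "(1, 0) \<in> set (adjacent (descent n))"
    using assms by (auto simp: adjacent_blocks)
  then have "occurs_before (0, 2) (1, 0) (([0..<2*n] @ [0..<2*n]) @ evens n @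
      (odds n @ [0..<2*n]) @ descent n @ ([0..<2*n] @ [0..<2*n]))"
    by (rule occurs_before_append)
  then show ?thesis by (simp add: good_word_def UT3_equiv_refl sandwich_def)
qed

lemma UT3_equiv_sandwich_descent:
  "UT3_equiv (sandwich [0..<2 * n] (evens n @ odds n) (descent n))
     (sandwich [0..<2 * n] (descent n) (evens n @ odds n))"
  by (rule UT3_equiv_sandwich[OF mset_evens_odds mset_descent])

lemma not_good_word_swapped:
  assumes n: "3 \<le> n"
  shows "\<not> good_word n (sandwich [0..<2 * n] (descent n) (evens n @ odds n))"
proof
  let ?w = "sandwich [0..<2 * n] (descent n) (evens n @ odds n)"
  assume good: "good_word n ?w"
  have mem: "(0, 2) \<in> set (adjacent (evens n))" "(1, 0) \<in> set (adjacent (descent n))"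
    using assms by (auto simp: adjacent_blocks)
  then have "occurs_before (1, 0) (0, 2) (([0..<2*n] @ [0..<2*n]) @ descent n @
      [0..<2*n] @ evens n @ (odds n @ [0..<2*n] @ [0..<2*n]))"
    by (intro occurs_before_append)
  then have "occurs_before (1, 0) (0, 2) ?w" by (simp add: sandwich_def)
  \<comment> \<open>Uniqueness of both pairs in the swapped word is carried over from the original
    word by the identity between them.\<close>
  moreover have "count_list (adjacent ?w) (0, 2) = 1" "count_list (adjacent ?w) (1, 0) = 1"
    using UT3_equiv_rigid[OF UT3_equiv_sandwich_descent rigid_evens[OF n]]
      UT3_equiv_rigid[OF UT3_equiv_sandwich_descent rigid_descent[OF n]] mem
    unfolding rigid_def by blast+
  ultimately show False using good occurs_before_asym unfolding good_word_def by metis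
qed

text \<open>Rigid blocks keep their order under short identities. In the bound, 2 accounts for the
  context letters added to \<open>s\<close> and 1 for the pigeonhole argument, as the shorter block
  has \<open>n\<close> letters.\<close>

lemma good_word_subst:
  assumes st: "UT3_equiv s t" and n: "length s + 3 < n"
    and good: "good_word n (a @ concat (map \<phi> s) @ b)"
  shows "good_word n (a @ concat (map \<phi> t) @ b)"
proof -
  \<comment> \<open>Two fresh letters absorb the contexts \<open>a\<close> and \<open>b\<close>.\<close>
  define ext where "ext r = [Inr False] @ concat (map (\<lambda>x. [Inl x]) r) @ [Inr True]" for r :: "'a list"
  define \<psi> where "\<psi> = case_sum \<phi> (\<lambda>c. if c then b else a)"
  have \<psi>: "concat (map \<psi> (ext r)) = a @ concat (map \<phi> r) @ b" for r
    by (induction r) (simp_all add: ext_def \<psi>_def)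
  have len: "length (ext r) = length r + 2" for r
    by (induction r) (simp_all add: ext_def)
  have eq: "UT3_equiv (ext s) (ext t)"
    unfolding ext_def by (rule UT3_equiv_subst[OF st])
  let ?u = "sandwich [0..<2 * n] (evens n @ odds n) (descent n)"
  have u: "UT3_equiv ?u (concat (map \<psi> (ext s)))" and
    bef: "occurs_before (0, 2) (1, 0) (concat (map \<psi> (ext s)))"
    using good by (simp_all add: \<psi> good_word_def)
  have "occurs_before (0, 2) (1, 0) (concat (map \<psi> (ext t)))"
  proof (rule subst_preserves_order[OF eq _ _ evens_descent_disjoint distinct_evens
        distinct_descent _ _ _ _ bef])
    show "rigid (evens n) (concat (map \<psi> (ext s)))" "rigid (descent n) (concat (map \<psi> (ext s)))"
      using UT3_equiv_rigid[OF u] rigid_evens rigid_descent n by simp_all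
    show "(0, 2) \<in> set (adjacent (evens n))" "(1, 0) \<in> set (adjacent (descent n))"
      using n by (auto simp: adjacent_blocks)
  qed (use n len[of s] in \<open>simp_all add: evens_def descent_def\<close>)
  then show ?thesis
    using UT3_equiv_trans[OF u] UT3_equiv_subst[OF eq, of "[]" \<psi> "[]"]
    by (simp add: \<psi> good_word_def)
qed

section \<open>Syntactic congruences\<close>

lemma word_star_append: "word_star (u @ v) = word_star v @ word_star u"
  by (simp add: word_star_def)

lemma word_star_Cons: "word_star (y # w) = word_star w @ [case_sum Inr Inl y]"
  by (simp add: word_star_def)

lemma word_star_word_star: "word_star (word_star w) = w"
proof -
  have "case_sum Inr Inl \<circ> case_sum Inr Inl = (id :: 'a + 'a \<Rightarrow> 'a + 'a)"
    by (auto simp: fun_eq_iff split: sum.split)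
  then show ?thesis by (simp add: word_star_def rev_map)
qed

lemma word_star_eq_Nil_iff [simp]: "word_star w = [] \<longleftrightarrow> w = []"
  by (simp add: word_star_def)

definition inv_subst :: "('a \<Rightarrow> ('a + 'a) list) \<Rightarrow> 'a + 'a \<Rightarrow> ('a + 'a) list" where
  "inv_subst \<sigma> = case_sum \<sigma> (word_star \<circ> \<sigma>)"

text \<open>The kernel of \<open>K\<close> is a congruence, and the quotient of the free semigroup
  by it, realised on the values of \<open>K\<close>, satisfies \<open>\<Sigma>\<close>. Consequences
  of \<open>\<Sigma>\<close> therefore hold there, in particular under the quotient map
  \<open>K\<close>.\<close>

lemma follows_from_kernel:
  fixes K :: "nat list \<Rightarrow> 'c"
  assumes inf: "infinite (UNIV :: 'u set)" and ff: "follows_from TYPE('u) \<Sigma> e"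
    and \<Sigma>: "\<Sigma> \<subseteq> words \<times> words" and e: "e \<in> words \<times> words"
    and cong: "\<And>u u' v v'. K u = K u' \<Longrightarrow> K v = K v' \<Longrightarrow> K (u @ v) = K (u' @ v')"
    and subst: "\<And>d \<sigma>. d \<in> \<Sigma> \<Longrightarrow> (\<And>x. \<sigma> x \<noteq> []) \<Longrightarrow>
      K (concat (map \<sigma> (fst d))) = K (concat (map \<sigma> (snd d)))"
  shows "K (fst e) = K (snd e)"
proof -
  define rep where "rep = inv_into words K"
  define g where "g c d = K (rep c @ rep d)" for c d
  have rep: "rep c \<noteq> []" "K (rep c) = c" if "c \<in> K ` words" for c
    using inv_into_into[OF that] f_inv_into_f[OF that] by (simp_all add: rep_def words_def)
  have g: "g (K u) (K v) = K (u @ v)" if "u \<in> words" "v \<in> words" for u v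
    unfolding g_def by (rule cong) (simp_all add: rep that)
  have app: "u @ v \<in> words" if "u \<in> words" for u v :: "nat list"
    using that by (simp add: words_def)
  have "semigroup_on (K ` words) g"
    unfolding semigroup_on_def by (simp add: g app)
  moreover have "satisfies (K ` words) g d" if d: "d \<in> \<Sigma>" for d
    unfolding satisfies_def
  proof (intro allI impI)
    fix \<psi> :: "nat list \<Rightarrow> 'c"
    assume \<psi>: "semigroup_hom words (@) (K ` words) g \<psi>"
    \<comment> \<open>Representatives of the values on letters lift a homomorphism into the quotient
      to a substitution.\<close>
    define \<sigma> where "\<sigma> x = rep (\<psi> [x])" for x
    have \<psi>1: "\<psi> [x] \<in> K ` words" for x
      using \<psi> unfolding semigroup_hom_def words_def by blast
    have \<sigma>: "\<sigma> x \<noteq> []" "K (\<sigma> x) = \<psi> [x]" for x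
      unfolding \<sigma>_def using rep[OF \<psi>1] by auto
    have val: "K (concat (map \<sigma> w)) = \<psi> w" if "w \<noteq> []" for w
      using that
    proof (induction w rule: list_nonempty_induct)
      case (cons x w)
      have cw: "concat (map \<sigma> w) \<noteq> []" using cons.hyps \<sigma>(1) by (cases w) simp_all
      have "\<psi> ([x] @ w) = g (\<psi> [x]) (\<psi> w)"
        using \<psi> cons.hyps unfolding semigroup_hom_def words_def by blast
      also have "\<dots> = g (K (\<sigma> x)) (K (concat (map \<sigma> w)))"
        by (simp add: \<sigma> cons.IH)
      also have "\<dots> = K (\<sigma> x @ concat (map \<sigma> w))"
        by (rule g) (simp_all add: words_def \<sigma> cw cons.hyps)
      finally show ?case by simp
    qed (simp add: \<sigma>)
    have "fst d \<noteq> []" "snd d \<noteq> []" using d \<Sigma> by (auto simp: words_def)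
    then show "\<psi> (fst d) = \<psi> (snd d)"
      using subst[OF d \<sigma>(1)] val[of "fst d"] val[of "snd d"] by simp
  qed
  ultimately have "satisfies (K ` words) g e"
    using follows_from_universal[OF inf ff] e \<Sigma> by blast
  moreover have "semigroup_hom words (@) (K ` words) g K"
    unfolding semigroup_hom_def by (simp add: g)
  ultimately show ?thesis unfolding satisfies_def by blast
qed

text \<open>The same quotient argument; compatibility of the kernel with \<open>word_star\<close>
  supplies the involution, and starred letters receive the stars of the representatives.\<close>

lemma inv_follows_from_kernel:
  fixes K :: "(nat + nat) list \<Rightarrow> 'c"
  assumes inf: "infinite (UNIV :: 'u set)" and ff: "inv_follows_from TYPE('u) \<Sigma> e"
    and \<Sigma>: "\<Sigma> \<subseteq> words \<times> words" and e: "e \<in> words \<times> words"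
    and cong: "\<And>u u' v v'. K u = K u' \<Longrightarrow> K v = K v' \<Longrightarrow> K (u @ v) = K (u' @ v')"
    and star: "\<And>u u'. K u = K u' \<Longrightarrow> K (word_star u) = K (word_star u')"
    and subst: "\<And>d \<sigma>. d \<in> \<Sigma> \<Longrightarrow> (\<And>x. \<sigma> x \<noteq> []) \<Longrightarrow>
      K (concat (map (inv_subst \<sigma>) (fst d))) = K (concat (map (inv_subst \<sigma>) (snd d)))"
  shows "K (fst e) = K (snd e)"
proof -
  define rep where "rep = inv_into words K"
  define g where "g c d = K (rep c @ rep d)" for c d
  define st where "st c = K (word_star (rep c))" for c
  have rep: "rep c \<noteq> []" "K (rep c) = c" if "c \<in> K ` words" for c
    using inv_into_into[OF that] f_inv_into_f[OF that] by (simp_all add: rep_def words_def)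
  have g: "g (K u) (K v) = K (u @ v)" if "u \<in> words" "v \<in> words" for u v
    unfolding g_def by (rule cong) (simp_all add: rep that)
  have st: "st (K u) = K (word_star u)" if "u \<in> words" for u
    unfolding st_def by (rule star) (simp add: rep that)
  have app: "u @ v \<in> words" if "u \<in> words" for u v :: "(nat + nat) list"
    using that by (simp add: words_def)
  have ws: "word_star u \<in> words" if "u \<in> words" for u :: "(nat + nat) list"
    using that by (simp add: words_def)
  have "inv_semigroup_on (K ` words) g st"
    unfolding inv_semigroup_on_def semigroup_on_def
    by (simp add: g st app ws word_star_append word_star_word_star)
  moreover have "inv_satisfies (K ` words) g st d" if d: "d \<in> \<Sigma>" for d
    unfolding inv_satisfies_def
  proof (intro allI impI)
    fix \<psi> :: "(nat + nat) list \<Rightarrow> 'c"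
    assume h: "inv_semigroup_hom words (@) word_star (K ` words) g st \<psi>"
    then have \<psi>: "semigroup_hom words (@) (K ` words) g \<psi>"
      by (simp add: inv_semigroup_hom_def)
    define \<sigma> where "\<sigma> x = rep (\<psi> [Inl x])" for x
    have \<psi>1: "\<psi> [x] \<in> K ` words" for x
      using \<psi> unfolding semigroup_hom_def words_def by blast
    have \<sigma>: "\<sigma> x \<noteq> []" "K (\<sigma> x) = \<psi> [Inl x]" for x
      unfolding \<sigma>_def using rep[OF \<psi>1] by auto
    have ne: "inv_subst \<sigma> x \<noteq> []" for x
      by (cases x) (simp_all add: inv_subst_def \<sigma>)
    have \<sigma>': "K (inv_subst \<sigma> x) = \<psi> [x]" for x
    proof (cases x)
      case (Inr y)
      have "\<psi> [x] = \<psi> (word_star [Inl y])" by (simp add: Inr word_star_def)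
      also have "\<dots> = st (\<psi> [Inl y])"
        using h by (simp add: inv_semigroup_hom_def words_def)
      also have "\<dots> = st (K (\<sigma> y))" by (simp add: \<sigma>)
      also have "\<dots> = K (word_star (\<sigma> y))" by (rule st) (simp add: words_def \<sigma>)
      finally show ?thesis by (simp add: Inr inv_subst_def)
    qed (simp add: inv_subst_def \<sigma>)
    have val: "K (concat (map (inv_subst \<sigma>) w)) = \<psi> w" if "w \<noteq> []" for w
      using that
    proof (induction w rule: list_nonempty_induct)
      case (cons x w)
      have cw: "concat (map (inv_subst \<sigma>) w) \<noteq> []" using cons.hyps ne by (cases w) simp_all
      have "\<psi> ([x] @ w) = g (\<psi> [x]) (\<psi> w)"
        using \<psi> cons.hyps unfolding semigroup_hom_def words_def by blast
      also have "\<dots> = g (K (inv_subst \<sigma> x)) (K (concat (map (inv_subst \<sigma>) w)))"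
        by (simp add: \<sigma>' cons.IH)
      also have "\<dots> = K (inv_subst \<sigma> x @ concat (map (inv_subst \<sigma>) w))"
        by (rule g) (simp_all add: words_def ne cw cons.hyps)
      finally show ?case by simp
    qed (simp add: \<sigma>')
    have "fst d \<noteq> []" "snd d \<noteq> []" using d \<Sigma> by (auto simp: words_def)
    then show "\<psi> (fst d) = \<psi> (snd d)"
      using subst[OF d \<sigma>(1)] val[of "fst d"] val[of "snd d"] by simp
  qed
  ultimately have "inv_satisfies (K ` words) g st e"
    using inv_follows_from_universal[OF inf ff] e \<Sigma> by blast
  moreover have "inv_semigroup_hom words (@) word_star (K ` words) g st K"
    unfolding inv_semigroup_hom_def semigroup_hom_def by (simp add: g st)
  ultimately show ?thesis unfolding inv_satisfies_def by blast
qed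

text \<open>Equality of \<open>contexts P\<close> is the syntactic congruence of \<open>P\<close>.
  The empty context is included, so congruent words agree on \<open>P\<close>.\<close>

definition contexts :: "('a list \<Rightarrow> bool) \<Rightarrow> 'a list \<Rightarrow> ('a list \<times> 'a list) set" where
  "contexts P w = {(a, b). P (a @ w @ b)}"

lemma contexts_append:
  assumes "contexts P u = contexts P u'" "contexts P v = contexts P v'"
  shows "contexts P (u @ v) = contexts P (u' @ v')"
proof -
  have u: "P (a @ u @ b) \<longleftrightarrow> P (a @ u' @ b)" and v: "P (a @ v @ b) \<longleftrightarrow> P (a @ v' @ b)" for a b
    using assms by (auto simp: contexts_def set_eq_iff)
  have "P (a @ u @ v @ b) \<longleftrightarrow> P (a @ u' @ v' @ b)" for a b
    using u[of a "v @ b"] v[of "a @ u'" b] by simp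
  then show ?thesis by (simp add: contexts_def)
qed

section \<open>Involutory identities\<close>

text \<open>A homomorphism from the free involution semigroup is determined by its values on the
  plain letters; starred letters receive the skew transposes.\<close>

definition UT3_inv_equiv :: "('a + 'a) list \<Rightarrow> ('a + 'a) list \<Rightarrow> bool" where
  "UT3_inv_equiv u v \<longleftrightarrow> (\<forall>m. range m \<subseteq> UT3 \<longrightarrow>
     eval_word (case_sum m (skew_transpose \<circ> m)) u = eval_word (case_sum m (skew_transpose \<circ> m)) v)"

lemma case_sum_skew_transpose_in_UT3:
  "(\<And>x. m x \<in> UT3) \<Longrightarrow> case_sum m (skew_transpose \<circ> m) y \<in> UT3"
  by (cases y) (simp_all add: skew_transpose_UT3)

lemma UT3_inv_equivD:
  "UT3_inv_equiv u v \<Longrightarrow> (\<And>x. m x \<in> UT3) \<Longrightarrow>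
   eval_word (case_sum m (skew_transpose \<circ> m)) u = eval_word (case_sum m (skew_transpose \<circ> m)) v"
  unfolding UT3_inv_equiv_def by blast

lemma UT3_inv_equiv_sym: "UT3_inv_equiv u v \<Longrightarrow> UT3_inv_equiv v u"
  by (simp add: UT3_inv_equiv_def)

lemma UT3_equiv_imp_inv_equiv:
  assumes "UT3_equiv u v"
  shows "UT3_inv_equiv u v"
  unfolding UT3_inv_equiv_def
proof (intro allI impI)
  fix m :: "'a \<Rightarrow> real^3^3" assume "range m \<subseteq> UT3"
  then have m: "m x \<in> UT3" for x by auto
  show "eval_word (case_sum m (skew_transpose \<circ> m)) u = eval_word (case_sum m (skew_transpose \<circ> m)) v"
    by (intro UT3_equivD[OF assms] case_sum_skew_transpose_in_UT3 m)
qed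

lemma eval_word_word_star:
  assumes m: "\<And>x. m x \<in> UT3"
  shows "eval_word (case_sum m (skew_transpose \<circ> m)) (word_star w) =
    skew_transpose (eval_word (case_sum m (skew_transpose \<circ> m)) w)"
proof (induction w)
  case Nil
  have "mat 1 = triangular 1 0 0"
    by (simp add: vec_eq_iff forall_3 mat_def)
  then show ?case by (simp add: word_star_def skew_transpose_triangular)
next
  case (Cons y w)
  let ?m = "case_sum m (skew_transpose \<circ> m)"
  have "?m (case_sum Inr Inl y) = skew_transpose (?m y)"
    by (cases y) (simp_all add: m skew_transpose_skew_transpose)
  moreover have "eval_word ?m w \<in> UT3"
    by (intro eval_word_in_UT3 case_sum_skew_transpose_in_UT3 m)
  moreover have "?m y \<in> UT3"
    by (intro case_sum_skew_transpose_in_UT3 m)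
  ultimately show ?case
    using Cons by (simp add: word_star_Cons skew_transpose_mult)
qed

lemma UT3_inv_equiv_word_star:
  assumes "UT3_inv_equiv s t"
  shows "UT3_inv_equiv (word_star s) (word_star t)"
  unfolding UT3_inv_equiv_def
proof (intro allI impI)
  fix m :: "'a \<Rightarrow> real^3^3" assume "range m \<subseteq> UT3"
  then have m: "m x \<in> UT3" for x by auto
  show "eval_word (case_sum m (skew_transpose \<circ> m)) (word_star s) =
      eval_word (case_sum m (skew_transpose \<circ> m)) (word_star t)"
    by (simp only: eval_word_word_star[where m = m, OF m] UT3_inv_equivD[OF assms m])
qed

lemma inv_satisfies_UT3_iff:
  assumes u: "u \<noteq> []" and v: "v \<noteq> []"
  shows "inv_satisfies UT3 (**) skew_transpose (u, v) \<longleftrightarrow> UT3_inv_equiv u v"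
proof
  assume L: "inv_satisfies UT3 (**) skew_transpose (u, v)"
  show "UT3_inv_equiv u v"
    unfolding UT3_inv_equiv_def
  proof (intro allI impI)
    fix m :: "nat \<Rightarrow> real^3^3" assume "range m \<subseteq> UT3"
    then have m: "m x \<in> UT3" for x by auto
    let ?m = "case_sum m (skew_transpose \<circ> m)"
    have "eval_word ?m w \<in> UT3" for w
      by (intro eval_word_in_UT3 case_sum_skew_transpose_in_UT3 m)
    then have "inv_semigroup_hom words (@) word_star UT3 (**) skew_transpose (eval_word ?m)"
      unfolding inv_semigroup_hom_def semigroup_hom_def
      by (simp add: eval_word_word_star[where m = m, OF m])
    with L show "eval_word ?m u = eval_word ?m v"
      unfolding inv_satisfies_def by (metis fst_conv snd_conv)
  qed
next
  assume R: "UT3_inv_equiv u v"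
  show "inv_satisfies UT3 (**) skew_transpose (u, v)"
    unfolding inv_satisfies_def
  proof (intro allI impI)
    fix \<phi> :: "(nat + nat) list \<Rightarrow> real^3^3"
    assume h: "inv_semigroup_hom words (@) word_star UT3 (**) skew_transpose \<phi>"
    then have h': "semigroup_hom words (@) UT3 (**) \<phi>" by (simp add: inv_semigroup_hom_def)
    define m where "m x = \<phi> [Inl x]" for x
    have m: "m x \<in> UT3" for x using h' by (simp add: m_def semigroup_hom_def words_def)
    have "\<phi> [y] = case_sum m (skew_transpose \<circ> m) y" for y
    proof (cases y)
      case (Inr x)
      have "\<phi> [y] = \<phi> (word_star [Inl x])" by (simp add: Inr word_star_def)
      also have "\<dots> = skew_transpose (\<phi> [Inl x])"
        using h by (simp add: inv_semigroup_hom_def words_def)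
      finally show ?thesis by (simp add: Inr m_def)
    qed (simp add: m_def)
    then have "(\<lambda>y. \<phi> [y]) = case_sum m (skew_transpose \<circ> m)" by (rule ext)
    then have "\<phi> w = eval_word (case_sum m (skew_transpose \<circ> m)) w" if "w \<noteq> []" for w
      using semigroup_hom_words_eval[OF h' that] by simp
    from this[OF u] this[OF v] show "\<phi> (fst (u, v)) = \<phi> (snd (u, v))"
      by (simp only: fst_conv snd_conv UT3_inv_equivD[OF R m])
  qed
qed

text \<open>The skew transpose exchanges the entries (1,2) and (2,3), so these two entries count the
  plain and the starred occurrences of a letter separately.\<close>

lemma UT3_inv_equiv_set:
  assumes eq: "UT3_inv_equiv s t"
  shows "set s = set t"
proof -
  have L: "case_sum (\<lambda>z. triangular 1 (of_bool (z = x)) 0)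
      (skew_transpose \<circ> (\<lambda>z. triangular 1 (of_bool (z = x)) 0)) = detector UNIV (Inl x) (Inr x)"
    and R: "case_sum (\<lambda>z. triangular 1 0 (of_bool (z = x)))
      (skew_transpose \<circ> (\<lambda>z. triangular 1 0 (of_bool (z = x)))) = detector UNIV (Inr x) (Inl x)"
    for x :: 'a
    by (auto simp: fun_eq_iff skew_transpose_triangular detector_def split: sum.split)
  have "count_list s y = count_list t y" for y
  proof (cases y)
    case (Inl x)
    have "eval_word (detector UNIV (Inr x) (Inl x)) s = eval_word (detector UNIV (Inr x) (Inl x)) t"
      unfolding R[symmetric] by (rule UT3_inv_equivD[OF eq]) (simp add: triangular_in_UT3)
    then show ?thesis
      using eval_word_detector[of UNIV "Inr x" "Inl x" s] eval_word_detector[of UNIV "Inr x" "Inl x" t]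
      by (simp add: prefix_count_UNIV Inl)
  next
    case (Inr x)
    have "eval_word (detector UNIV (Inl x) (Inr x)) s = eval_word (detector UNIV (Inl x) (Inr x)) t"
      unfolding L[symmetric] by (rule UT3_inv_equivD[OF eq]) (simp add: triangular_in_UT3)
    then show ?thesis
      using eval_word_detector[of UNIV "Inl x" "Inr x" s] eval_word_detector[of UNIV "Inl x" "Inr x" t]
      by (simp add: prefix_count_UNIV Inr)
  qed
  then show ?thesis by (auto simp: set_eq_iff) (metis count_list_0_iff)+
qed

text \<open>If each letter occurs in one form only, any values can be prescribed: a letter that
  occurs starred is sent to the skew transpose of the desired value. The word \<open>t\<close>
  involves the same letters.\<close>

lemma UT3_inv_equiv_imp_equiv:
  assumes eq: "UT3_inv_equiv s t" and s: "\<And>x. \<not> (Inl x \<in> set s \<and> Inr x \<in> set s)"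
  shows "UT3_equiv s t"
  unfolding UT3_equiv_def
proof (intro allI impI)
  fix m :: "'a + 'a \<Rightarrow> real^3^3" assume "range m \<subseteq> UT3"
  then have m: "m y \<in> UT3" for y by auto
  define m' where "m' x = (if Inl x \<in> set s then m (Inl x) else skew_transpose (m (Inr x)))" for x
  let ?m = "case_sum m' (skew_transpose \<circ> m')"
  have m': "m' x \<in> UT3" for x by (simp add: m'_def m skew_transpose_UT3)
  have *: "m y = ?m y" if "y \<in> set s" for y
  proof (cases y)
    case (Inr x)
    then have "Inl x \<notin> set s" using that s by blast
    then show ?thesis by (simp add: Inr m'_def m skew_transpose_skew_transpose)
  qed (use that in \<open>simp add: m'_def\<close>)
  have "eval_word m s = eval_word ?m s" by (rule eval_word_cong) (rule *)
  also have "\<dots> = eval_word ?m t" by (rule UT3_inv_equivD[OF eq m'])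
  also have "\<dots> = eval_word m t"
    by (rule eval_word_cong) (simp add: * UT3_inv_equiv_set[OF eq])
  finally show "eval_word m s = eval_word m t" .
qed

definition inv_good_word :: "nat \<Rightarrow> (nat + nat) list \<Rightarrow> bool" where
  "inv_good_word n w \<longleftrightarrow> (\<exists>w'. w = map Inl w' \<and> good_word n w')"

text \<open>An unstarred value forces every letter of \<open>s\<close> to occur only plainly or only starred, so
  that the involutory identity acts as a plain one.\<close>

lemma inv_good_word_subst:
  assumes st: "UT3_inv_equiv s t" and n: "length s + 3 < n" and \<sigma>: "\<And>x. \<sigma> x \<noteq> []"
    and good: "inv_good_word n (a @ concat (map (inv_subst \<sigma>) s) @ b)"
  shows "inv_good_word n (a @ concat (map (inv_subst \<sigma>) t) @ b)"
proof -
  let ?\<phi> = "inv_subst \<sigma>"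
  obtain w where w: "a @ concat (map ?\<phi> s) @ b = map Inl w" "good_word n w"
    using good unfolding inv_good_word_def by blast
  then obtain a' c' b' where abc: "a = map Inl a'" "concat (map ?\<phi> s) = map Inl c'"
      "b = map Inl b'" and w': "w = a' @ c' @ b'"
    by (auto simp: append_eq_map_conv)
  have "set (concat (map ?\<phi> s)) \<subseteq> range Inl" unfolding abc(2) by auto
  then have plain: "set (?\<phi> y) \<subseteq> range Inl" if "y \<in> set s" for y
    using that by auto
  have "\<not> (Inl x \<in> set s \<and> Inr x \<in> set s)" for x
  proof
    assume x: "Inl x \<in> set s \<and> Inr x \<in> set s"
    obtain y where y: "y \<in> set (\<sigma> x)" using \<sigma>[of x] by (meson last_in_set)
    have "y \<in> range Inl" using plain[of "Inl x"] x y by (auto simp: inv_subst_def)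
    moreover have "case_sum Inr Inl y \<in> range Inl"
      using plain[of "Inr x"] x y by (auto simp: inv_subst_def word_star_def)
    ultimately show False by auto
  qed
  then have eq: "UT3_equiv s t" by (rule UT3_inv_equiv_imp_equiv[OF st])
  \<comment> \<open>\<open>projl\<close> is unspecified on starred letters, but the values on
    letters of \<open>s\<close> are unstarred and \<open>t\<close> has no other letters.\<close>
  define \<psi> where "\<psi> y = map projl (?\<phi> y)" for y
  have \<phi>\<psi>: "?\<phi> y = map Inl (\<psi> y)" if "y \<in> set s" for y
  proof -
    have "map (Inl \<circ> projl) (?\<phi> y) = map id (?\<phi> y)"
      by (rule map_cong) (use plain[OF that] in auto)
    then show ?thesis by (simp add: \<psi>_def)
  qed
  have \<phi>r: "concat (map ?\<phi> r) = map Inl (concat (map \<psi> r))" if "set r \<subseteq> set s" for r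
    using that by (induction r) (simp_all add: \<phi>\<psi>)
  have "map Inl c' = (map Inl (concat (map \<psi> s)) :: (nat + nat) list)"
    using abc(2) \<phi>r[of s] by simp
  then have "c' = concat (map \<psi> s)" by (simp add: inj_map_eq_map)
  then have "good_word n (a' @ concat (map \<psi> t) @ b')"
    using good_word_subst[OF eq n] w(2) w' by simp
  moreover have "a @ concat (map ?\<phi> t) @ b = map Inl (a' @ concat (map \<psi> t) @ b')"
    using \<phi>r[of t] UT3_inv_equiv_set[OF st] by (simp add: abc)
  ultimately show ?thesis unfolding inv_good_word_def by blast
qed

section \<open>The finite basis problem\<close>

lemma ex_length_bound:
  fixes \<Sigma> :: "('a list \<times> 'a list) set"
  assumes "finite \<Sigma>"
  obtains n where "\<And>d. d \<in> \<Sigma> \<Longrightarrow> length (fst d) + 3 < n \<and> length (snd d) + 3 < n" "3 \<le> n"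
proof -
  let ?f = "\<lambda>d :: 'a list \<times> 'a list. length (fst d) + length (snd d)"
  have "?f d \<le> sum ?f \<Sigma>" if "d \<in> \<Sigma>" for d
    by (rule member_le_sum) (use that assms in auto)
  then show ?thesis by (intro that[of "sum ?f \<Sigma> + 4"]) fastforce+
qed

lemma sandwich_in_words: "f \<noteq> [] \<Longrightarrow> sandwich f X Y \<in> words"
  by (simp add: sandwich_def words_def)

text \<open>For \<open>n\<close> beyond the lengths in a finite basis, the syntactic congruence of
  the good words contains all instances of the basis, yet separates the two sides of the sandwich
  identity.\<close>

lemma UT3_not_finitely_based:
  assumes inf: "infinite (UNIV :: 'u set)"
  shows "\<not> finitely_based TYPE('u) UT3 (**)"
proof
  assume "finitely_based TYPE('u) UT3 (**)"
  then obtain \<Sigma> where \<Sigma>: "\<Sigma> \<subseteq> words \<times> words" "finite \<Sigma>"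
      "\<And>d. d \<in> \<Sigma> \<Longrightarrow> satisfies UT3 (**) d"
    and ff: "\<And>e. e \<in> words \<times> words \<Longrightarrow> satisfies UT3 (**) e \<Longrightarrow> follows_from TYPE('u) \<Sigma> e"
    unfolding finitely_based_def by blast
  obtain n where n: "\<And>d. d \<in> \<Sigma> \<Longrightarrow> length (fst d) + 3 < n \<and> length (snd d) + 3 < n" "3 \<le> n"
    using ex_length_bound[OF \<Sigma>(2)] by blast
  define u v where "u = sandwich [0..<2 * n] (evens n @ odds n) (descent n)"
    and "v = sandwich [0..<2 * n] (descent n) (evens n @ odds n)"
  have uv: "u \<in> words" "v \<in> words"
    using n(2) by (auto simp: u_def v_def intro!: sandwich_in_words)
  have "satisfies UT3 (**) (u, v)"
    using uv UT3_equiv_sandwich_descent[of n]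
    by (subst satisfies_UT3_iff) (simp_all add: words_def u_def v_def)
  then have "follows_from TYPE('u) \<Sigma> (u, v)" using ff uv by simp
  then have "contexts (good_word n) (fst (u, v)) = contexts (good_word n) (snd (u, v))"
  proof (rule follows_from_kernel[OF inf _ \<Sigma>(1)])
    fix d and \<sigma> :: "nat \<Rightarrow> nat list" assume d: "d \<in> \<Sigma>"
    have "fst d \<noteq> []" "snd d \<noteq> []" using d \<Sigma>(1) by (auto simp: words_def)
    then have "UT3_equiv (fst d) (snd d)"
      using \<Sigma>(3)[OF d] satisfies_UT3_iff[of "fst d" "snd d"] by simp
    then show "contexts (good_word n) (concat (map \<sigma> (fst d))) =
        contexts (good_word n) (concat (map \<sigma> (snd d)))"
      \<comment> \<open>Equality of contexts needs the identity in both directions, hence the length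
        bound on both of its sides.\<close>
      unfolding contexts_def using n(1)[OF d] by (blast intro: good_word_subst UT3_equiv_sym)
  next
    fix x x' y y'
    assume "contexts (good_word n) x = contexts (good_word n) x'"
      "contexts (good_word n) y = contexts (good_word n) y'"
    then show "contexts (good_word n) (x @ y) = contexts (good_word n) (x' @ y')"
      by (rule contexts_append)
  qed (use uv in simp)
  then have "([], []) \<in> contexts (good_word n) u \<longleftrightarrow> ([], []) \<in> contexts (good_word n) v"
    by simp
  then show False
    using good_word_sandwich[OF n(2)] not_good_word_swapped[OF n(2)]
    by (simp add: contexts_def u_def v_def)
qed

lemma UT3_not_inv_finitely_based:
  assumes inf: "infinite (UNIV :: 'u set)"
  shows "\<not> inv_finitely_based TYPE('u) UT3 (**) skew_transpose"
proof
  assume "inv_finitely_based TYPE('u) UT3 (**) skew_transpose"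
  then obtain \<Sigma> where \<Sigma>: "\<Sigma> \<subseteq> words \<times> words" "finite \<Sigma>"
      "\<And>d. d \<in> \<Sigma> \<Longrightarrow> inv_satisfies UT3 (**) skew_transpose d"
    and ff: "\<And>e. e \<in> words \<times> words \<Longrightarrow> inv_satisfies UT3 (**) skew_transpose e \<Longrightarrow>
      inv_follows_from TYPE('u) \<Sigma> e"
    unfolding inv_finitely_based_def by blast
  obtain n where n: "\<And>d. d \<in> \<Sigma> \<Longrightarrow> length (fst d) + 3 < n \<and> length (snd d) + 3 < n" "3 \<le> n"
    using ex_length_bound[OF \<Sigma>(2)] by blast
  define u v :: "(nat + nat) list"
    where "u = map Inl (sandwich [0..<2 * n] (evens n @ odds n) (descent n))"
      and "v = map Inl (sandwich [0..<2 * n] (descent n) (evens n @ odds n))"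
  have uv: "u \<in> words" "v \<in> words"
    using n(2) by (auto simp: u_def v_def words_def sandwich_def)
  have "UT3_inv_equiv u v"
    unfolding u_def v_def
    by (intro UT3_equiv_imp_inv_equiv UT3_equiv_map UT3_equiv_sandwich_descent)
  then have "inv_satisfies UT3 (**) skew_transpose (u, v)"
    using uv by (subst inv_satisfies_UT3_iff) (simp_all add: words_def)
  then have ff': "inv_follows_from TYPE('u) \<Sigma> (u, v)" using ff uv by simp
  let ?C = "contexts (inv_good_word n)"
  \<comment> \<open>The syntactic congruence of the unstarred good words need not respect
    \<open>word_star\<close>. Recording the contexts of the star as well repairs this, since
    starring exchanges the two components.\<close>
  define K where "K w = (?C w, ?C (word_star w))" for w
  have C: "?C (concat (map (inv_subst \<sigma>) s)) = ?C (concat (map (inv_subst \<sigma>) t))"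
    if "UT3_inv_equiv s t" "length s + 3 < n" "length t + 3 < n" "\<And>x. \<sigma> x \<noteq> []" for s t \<sigma>
    unfolding contexts_def using that by (blast intro: inv_good_word_subst UT3_inv_equiv_sym)
  \<comment> \<open>The star of an instance of an identity is an instance of the starred identity,
    which also holds in \<open>UT3\<close> and has the same lengths.\<close>
  have star: "word_star (concat (map (inv_subst \<sigma>) s)) =
      concat (map (inv_subst \<sigma>) (word_star s))" for s :: "(nat + nat) list" and \<sigma>
  proof (induction s)
    case (Cons y s)
    then show ?case
      by (cases y) (simp_all add: word_star_append word_star_Cons inv_subst_def
          word_star_word_star)
  qed (simp add: word_star_def)
  from ff' have "K (fst (u, v)) = K (snd (u, v))"
  proof (rule inv_follows_from_kernel[OF inf _ \<Sigma>(1)])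
    fix d and \<sigma> :: "nat \<Rightarrow> (nat + nat) list" assume d: "d \<in> \<Sigma>" and \<sigma>: "\<And>x. \<sigma> x \<noteq> []"
    have "fst d \<noteq> []" "snd d \<noteq> []" using d \<Sigma>(1) by (auto simp: words_def)
    then have eq: "UT3_inv_equiv (fst d) (snd d)"
      using \<Sigma>(3)[OF d] inv_satisfies_UT3_iff[of "fst d" "snd d"] by simp
    have len: "length (word_star w) = length w" for w :: "(nat + nat) list"
      by (simp add: word_star_def)
    show "K (concat (map (inv_subst \<sigma>) (fst d))) = K (concat (map (inv_subst \<sigma>) (snd d)))"
      unfolding K_def star
      using C[OF eq _ _ \<sigma>] C[OF UT3_inv_equiv_word_star[OF eq] _ _ \<sigma>] n(1)[OF d]
      by (simp add: len)
  next
    fix x x' y y' assume "K x = K x'" "K y = K y'"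
    then show "K (x @ y) = K (x' @ y')"
      unfolding K_def word_star_append prod.inject by (intro conjI contexts_append) simp_all
  qed (use uv in \<open>auto simp: K_def word_star_word_star\<close>)
  then have "([], []) \<in> ?C u \<longleftrightarrow> ([], []) \<in> ?C v" by (simp add: K_def)
  moreover have "inv_good_word n u"
    unfolding inv_good_word_def u_def using good_word_sandwich[OF n(2)] by blast
  moreover have "\<not> inv_good_word n v"
    unfolding inv_good_word_def v_def using not_good_word_swapped[OF n(2)]
    by (auto simp: inj_map_eq_map)
  ultimately show False by (simp add: contexts_def)
qed

theorem theorem2:
  assumes "infinite (UNIV :: 'u set)"
  shows "\<not> finitely_based TYPE('u) UT3 (**) \<and>
         \<not> inv_finitely_based TYPE('u) UT3 (**) skew_transpose"
  using UT3_not_finitely_based[OF assms] UT3_not_inv_finitely_based[OF assms] by simp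

end
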